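(* For every arc $I\subset\mathbb{T}$ with $I\neq\mathbb{T}$ and every $\omega>0$, $$\sup_{F\in\mathcal{S}^*(\mathbb{Z}),\ \|F\|_{\ell^2(\mathbb{Z})}\leqslant\omega}\ \inf_{z\in I}\ \sup_{N\in\mathbb{Z}^+}\big|\arg\mathfrak{a}^{( * )}(z,F^{\langle N\rangle})\big|=+\infty.$$
   Context: $\mathbb{T}$, $\mathbb{D}$ are the unit circle and open unit disc, $\mathbb{Z}^+=\{0,1,\dots\}$, $m$ is normalized Lebesgue measure on $\mathbb{T}$. $\mathcal{S}^*(\mathbb{Z})$ is the set of sequences $F=\{F_n\}_{n\in\mathbb{Z}}$ with $\sup_n|F_n|<1$ and, for every $\ell\in\mathbb{Z}^+$, $|F_n|\leqslant C_\ell(1+|n|)^{-\ell}$ for all $n$. Truncation: $F^{\langle N\rangle}_n=F_n\chi_{|n|\leqslant N}$. For a finitely supported sequence $G$ with values in $\mathbb{D}$: let $\widetilde X_n(z)=I$ for $n$ below the support of $G$ and $\widetilde X_n=(1-|G_n|^2)^{-1/2}\begin{pmatrix}1&\overline{G_n}z^{-n}\\ G_nz^n&1\end{pmatrix}\widetilde X_{n-1}$; for $n$ above the support $\widetilde X_n=\begin{pmatrix}\mathfrak{a}(z,G)&\mathfrak{b}^{( * )}(z,G)\\ \mathfrak{b}(z,G)&\mathfrak{a}^{( * )}(z,G)\end{pmatrix}$ with $f^{( * )}(z)=\overline{f(\bar z^{-1})}$. Then $\mathfrak{a}^{( * )}(\cdot,G)$ is analytic in $\mathbb{D}$, continuous on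 $\overline{\mathbb{D}}$, outer, with $|\mathfrak{a}^{( * )}(\xi,G)|^2=1+|\mathfrak{b}(\xi,G)|^2$ on $\mathbb{T}$ and $\mathfrak{a}^{( * )}(0,G)>0$. Its argument is defined by $\arg\mathfrak{a}^{( * )}(z,G)=\frac12\int_{\mathbb{T}}\operatorname{Im}\big(\frac{\xi+z}{\xi-z}\big)\log(1+|\mathfrak{b}(\xi,G)|^2)\,dm(\xi)$ for $z\in\mathbb{D}$, and for $z=e^{i\phi}\in\mathbb{T}$ by the principal-value integral $\arg\mathfrak{a}^{( * )}(e^{i\phi},G)=\frac1{4\pi}\,\mathrm{p.v.}\int_0^{2\pi}\cot\big(\frac{\phi-\theta}2\big)\log(1+|\mathfrak{b}(e^{i\theta},G)|^2)\,d\theta$. *)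

theory Defs
  imports "HOL-Analysis.Analysis"
begin

type_synonym cmat2 = "complex \<times> complex \<times> complex \<times> complex"

definition mat2_mult :: "cmat2 \<Rightarrow> cmat2 \<Rightarrow> cmat2" where
  "mat2_mult A B = (case A of (a11, a12, a21, a22) \<Rightarrow> case B of (b11, b12, b21, b22) \<Rightarrow>
     (a11*b11 + a12*b21, a11*b12 + a12*b22, a21*b11 + a22*b21, a21*b12 + a22*b22))"

definition mat2_id :: cmat2 where "mat2_id = (1, 0, 0, 1)"

definition mat2_21 :: "cmat2 \<Rightarrow> complex" where
  "mat2_21 A = (case A of (a11, a12, a21, a22) \<Rightarrow> a21)"

definition nlft_step :: "(int \<Rightarrow> complex) \<Rightarrow> complex \<Rightarrow> int \<Rightarrow> cmat2" where
  "nlft_step G z n =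
     (let c = complex_of_real (1 / sqrt (1 - (cmod (G n))\<^sup>2)) in
      (c, c * cnj (G n) * z powi (- n), c * G n * z powi n, c))"

fun nlft_prod :: "(int \<Rightarrow> complex) \<Rightarrow> complex \<Rightarrow> int \<Rightarrow> nat \<Rightarrow> cmat2" where
  "nlft_prod G z m 0 = mat2_id"
| "nlft_prod G z m (Suc k) = mat2_mult (nlft_step G z (m + int k)) (nlft_prod G z m k)"

definition supp_bound :: "(int \<Rightarrow> complex) \<Rightarrow> nat" where
  "supp_bound G = (LEAST M. \<forall>n. int M < \<bar>n\<bar> \<longrightarrow> G n = 0)"

text \<open>\<open>\<frak>b(z,G)\<close>: lower-left entry of the transfer matrix above the support of G
  (factors outside the support are the identity).\<close>
definition nlft_b :: "(int \<Rightarrow> complex) \<Rightarrow> complex \<Rightarrow> complex" where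
  "nlft_b G z = (let M = supp_bound G in
                 mat2_21 (nlft_prod G z (- int M) (2 * M + 1)))"

text \<open>arg \<open>\<frak>a^(*)(e^{i\<phi>},G)\<close> on the circle, via the principal value integral
  (1/(4\<pi>)) p.v.\<integral> cot((\<phi>-\<theta>)/2) log(1+|\<frak>b(e^{i\<theta>},G)|^2) d\<theta>;
  by 2\<pi>-periodicity we integrate over t = \<phi>-\<theta> in [-\<pi>,\<pi>], removing |t| < \<epsilon>.\<close>
definition arg_a_star :: "(int \<Rightarrow> complex) \<Rightarrow> complex \<Rightarrow> real" where
  "arg_a_star G z = (let \<phi> = Arg z in
     (1 / (4 * pi)) *
       Lim (at_right 0) (\<lambda>\<epsilon>. integral {t. \<epsilon> \<le> \<bar>t\<bar> \<and> \<bar>t\<bar> \<le> pi}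
            (\<lambda>t. cot (t / 2) * ln (1 + (cmod (nlft_b G (cis (\<phi> - t))))\<^sup>2))))"

definition Sstar :: "(int \<Rightarrow> complex) set" where
  "Sstar = {F. (\<exists>c<1. \<forall>n. cmod (F n) \<le> c) \<and>
               (\<forall>l::nat. \<exists>C. \<forall>n. cmod (F n) \<le> C / (1 + real_of_int \<bar>n\<bar>) ^ l)}"

definition l2norm :: "(int \<Rightarrow> complex) \<Rightarrow> real" where
  "l2norm F = sqrt (infsum (\<lambda>n. (cmod (F n))\<^sup>2) UNIV)"

definition trunc :: "nat \<Rightarrow> (int \<Rightarrow> complex) \<Rightarrow> int \<Rightarrow> complex" where
  "trunc N F n = (if \<bar>n\<bar> \<le> int N then F n else 0)"

definition is_arc :: "complex set \<Rightarrow> bool" where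
  "is_arc I \<longleftrightarrow> (\<exists>J::real set. connected J \<and> I = cis ` J)"

end

theory Submission
  imports Defs "HOL-Complex_Analysis.Conformal_Mappings"
begin

text \<open>
  If \<open>log (1 + |\<bb>|\<^sup>2)\<close> is close to a constant \<open>c\<close> on an arc and to 0 outside, its conjugate function is
  about \<open>c\<close> times the logarithm of the resolution at the endpoints of the arc. Hence one lets
  the arc grow with the truncation parameter, so that its endpoint sweeps over the whole circle while
  the total mass stays of order \<open>c\<close>.

  Concretely, \<open>F\<close> is a concatenation of \<open>5 J\<close> rotated copies of a tent-shaped block of length
  \<open>2 J\<close> and height \<open>\<epsilon> / J\<close>; copy \<open>i\<close> is a bump of width \<open>1 / J\<close> around the angle
  \<open>\<pi> i / (2 J)\<close>. At distance \<open>\<pi> m / (2 J)\<close> to its right a copy has argument at least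
  \<open>c \<epsilon>\<^sup>2 / m - O(1 / m\<^sup>2)\<close>. Since \<open>\<aa>\<^sup>(\<^sup>*\<^sup>)\<close> of a concatenation is the product of the two
  factors times \<open>1 + r\<close> with \<open>|r| \<le> |\<bb>|\<close> of the new block, the arguments add up to
  \<open>O(|\<bb>|) = O(1 / m\<^sup>2)\<close>. So between the truncations lying a quarter turn before \<open>z\<close> and
  just before \<open>z\<close> the argument at \<open>z\<close> grows by \<open>c \<epsilon>\<^sup>2 log J - O(1)\<close>, and one of the two
  values is large.
\<close>

section \<open>Principal value integrals and conjugate functions\<close>

text \<open>The factor 1 / (2 * pi) of the conjugate function is left out. Continuity of
  \<open>u\<close> is included because it makes the punctured integrals exist and add; existence of
  the limit is part of the claim, unlike with \<open>Lim\<close>.\<close>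

definition has_pv_conjugate :: "(complex \<Rightarrow> real) \<Rightarrow> complex \<Rightarrow> real \<Rightarrow> bool" where
  "has_pv_conjugate u z v \<longleftrightarrow> continuous_on (sphere 0 1) u \<and>
     ((\<lambda>\<epsilon>. integral {t. \<epsilon> \<le> \<bar>t\<bar> \<and> \<bar>t\<bar> \<le> pi} (\<lambda>t. cot (t / 2) * u (z * cis (- t))))
        \<longlongrightarrow> v) (at_right 0)"

lemma punctured_interval_eq:
  assumes "0 < e" "e < pi"
  shows "{t::real. e \<le> \<bar>t\<bar> \<and> \<bar>t\<bar> \<le> pi} = {-pi..-e} \<union> {e..pi}"
  using assms by auto

lemma punctured_has_integral:
  fixes f :: "real \<Rightarrow> real"
  assumes "0 < e" "e < pi" "(f has_integral i) {-pi..-e}" "(f has_integral j) {e..pi}"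
  shows "(f has_integral (i + j)) {t. e \<le> \<bar>t\<bar> \<and> \<bar>t\<bar> \<le> pi}"
  unfolding punctured_interval_eq[OF assms(1,2)]
proof (rule has_integral_Un[OF assms(3,4)])
  have "{-pi..-e} \<inter> {e..pi} = {}" using assms by auto
  thus "negligible ({-pi..-e} \<inter> {e..pi})" by simp
qed

lemma continuous_on_cot_half:
  assumes "0 < e"
  shows "continuous_on ({-pi..-e} \<union> {e..pi}) (\<lambda>t::real. cot (t / 2))"
proof -
  have "sin (t/2) \<noteq> 0" if "t \<in> {-pi..-e} \<union> {e..pi}" for t
  proof (cases "t > 0")
    case True
    with that assms have "0 < t/2" "t/2 < pi" by auto
    thus ?thesis using sin_gt_zero[of "t/2"] by simp
  next
    case False
    with that assms have "0 < -t/2" "-t/2 < pi" by auto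
    thus ?thesis using sin_gt_zero[of "-t/2"] by simp
  qed
  thus ?thesis unfolding cot_def by (intro continuous_intros) auto
qed

lemma punctured_integrable:
  fixes u :: "real \<Rightarrow> real"
  assumes e: "0 < e" "e < pi" and u: "continuous_on UNIV u"
  shows "(\<lambda>t. cot (t/2) * u t) integrable_on {-pi..-e}"
    and "(\<lambda>t. cot (t/2) * u t) integrable_on {e..pi}"
    and "(\<lambda>t. cot (t/2) * u t) integrable_on {t. e \<le> \<bar>t\<bar> \<and> \<bar>t\<bar> \<le> pi}"
proof -
  have c: "continuous_on ({-pi..-e} \<union> {e..pi}) (\<lambda>t. cot (t/2) * u t)"
    by (intro continuous_intros continuous_on_cot_half e continuous_on_subset[OF u]) auto
  show 1: "(\<lambda>t. cot (t/2) * u t) integrable_on {-pi..-e}"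
    by (rule integrable_continuous_real, rule continuous_on_subset[OF c]) auto
  show 2: "(\<lambda>t. cot (t/2) * u t) integrable_on {e..pi}"
    by (rule integrable_continuous_real, rule continuous_on_subset[OF c]) auto
  show "(\<lambda>t. cot (t/2) * u t) integrable_on {t. e \<le> \<bar>t\<bar> \<and> \<bar>t\<bar> \<le> pi}"
    using punctured_has_integral[OF e] 1 2 unfolding integrable_on_def by blast
qed

lemma continuous_on_rotate:
  assumes "continuous_on (sphere 0 1) u" "norm z = 1"
  shows "continuous_on UNIV (\<lambda>t. u (z * cis (- t)))"
  by (rule continuous_on_compose2[OF assms(1)])
     (use assms(2) in \<open>auto intro!: continuous_intros simp: norm_mult\<close>)

lemma eventually_small_at_right:
  "eventually (\<lambda>e::real. 0 < e \<and> e < pi) (at_right 0)"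
  unfolding eventually_at_right_field by (rule exI[of _ pi]) auto

lemma has_pv_conjugate_add:
  assumes z: "norm z = 1" and u: "has_pv_conjugate u z a" and w: "has_pv_conjugate w z b"
  shows "has_pv_conjugate (\<lambda>x. u x + w x) z (a + b)"
proof -
  let ?I = "\<lambda>u \<epsilon>. integral {t. \<epsilon> \<le> \<bar>t\<bar> \<and> \<bar>t\<bar> \<le> pi} (\<lambda>t. cot (t / 2) * u (z * cis (- t)))"
  have cu: "continuous_on (sphere 0 1) u" and cw: "continuous_on (sphere 0 1) w"
    using u w by (auto simp: has_pv_conjugate_def)
  have "((\<lambda>\<epsilon>. ?I u \<epsilon> + ?I w \<epsilon>) \<longlongrightarrow> a + b) (at_right 0)"
    using u w by (intro tendsto_add) (auto simp: has_pv_conjugate_def)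
  moreover have "eventually (\<lambda>\<epsilon>. ?I u \<epsilon> + ?I w \<epsilon> = ?I (\<lambda>x. u x + w x) \<epsilon>) (at_right 0)"
    using eventually_small_at_right
  proof eventually_elim
    case (elim \<epsilon>)
    show ?case
      using integral_add[OF punctured_integrable(3)[OF _ _ continuous_on_rotate[OF cu z]]
          punctured_integrable(3)[OF _ _ continuous_on_rotate[OF cw z]], of \<epsilon>] elim
      by (simp add: algebra_simps)
  qed
  ultimately have "(?I (\<lambda>x. u x + w x) \<longlongrightarrow> a + b) (at_right 0)"
    by (rule Lim_transform_eventually)
  thus ?thesis
    using continuous_on_add[OF cu cw] unfolding has_pv_conjugate_def by blast
qed

lemma has_pv_conjugate_cmult:
  assumes "has_pv_conjugate u z a"
  shows "has_pv_conjugate (\<lambda>x. c * u x) z (c * a)"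
proof -
  have "((\<lambda>\<epsilon>. c * integral {t. \<epsilon> \<le> \<bar>t\<bar> \<and> \<bar>t\<bar> \<le> pi} (\<lambda>t. cot (t / 2) * u (z * cis (- t)))) \<longlongrightarrow> c * a) (at_right 0)"
    using assms by (intro tendsto_mult tendsto_const) (auto simp: has_pv_conjugate_def)
  thus ?thesis
    using assms unfolding has_pv_conjugate_def
    by (simp add: mult.left_commute[of _ c] continuous_on_mult_left)
qed

lemma integral_cot_half_punctured:
  assumes e: "0 < e" "e < pi"
  shows "integral {t. e \<le> \<bar>t\<bar> \<and> \<bar>t\<bar> \<le> pi} (\<lambda>t. cot (t/2)) = (0::real)"
proof -
  have "(\<lambda>t. cot (t/2)) integrable_on {e..pi}"
    using punctured_integrable(2)[OF e, of "\<lambda>_. 1"] by simp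
  then obtain i where i: "((\<lambda>t::real. cot (t/2)) has_integral i) {e..pi}" by blast
  hence "((\<lambda>t::real. cot (- t/2)) has_integral i) {-pi..-e}"
    using has_integral_reflect_real[where f = "\<lambda>t::real. cot (t/2)" and i = i and a = e and b = pi] by (simp add: e)
  moreover have "cot (- t/2) = - cot (t/2)" for t :: real by (simp add: cot_def)
  ultimately have "((\<lambda>t::real. - cot (t/2)) has_integral i) {-pi..-e}" by simp
  from has_integral_neg[OF this] have "((\<lambda>t::real. cot (t/2)) has_integral - i) {-pi..-e}" by simp
  from punctured_has_integral[OF e this i] show ?thesis by (simp add: integral_unique)
qed

text \<open>Oddness of the cotangent. This makes the normalising constant of the transfer matrices
  invisible to the argument.\<close>

lemma has_pv_conjugate_const: "has_pv_conjugate (\<lambda>_. c) z 0"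
proof -
  have "eventually (\<lambda>\<epsilon>. 0 = integral {t. \<epsilon> \<le> \<bar>t\<bar> \<and> \<bar>t\<bar> \<le> pi} (\<lambda>t. cot (t / 2) * c)) (at_right 0)"
    using eventually_small_at_right
    by eventually_elim (simp add: integral_cot_half_punctured)
  from Lim_transform_eventually[OF tendsto_const this] show ?thesis
    unfolding has_pv_conjugate_def by simp
qed

lemma has_pv_conjugate_sum:
  assumes "norm z = 1" "finite S" "\<And>i. i \<in> S \<Longrightarrow> has_pv_conjugate (u i) z (a i)"
  shows "has_pv_conjugate (\<lambda>x. \<Sum>i\<in>S. u i x) z (\<Sum>i\<in>S. a i)"
  using assms(2,3)
proof (induction S rule: finite_induct)
  case empty
  show ?case by (simp add: has_pv_conjugate_const)
next
  case (insert i S)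
  show ?case
    using has_pv_conjugate_add[OF assms(1), of "u i" "a i"] insert by simp
qed

lemma has_pv_conjugate_cong:
  assumes "norm z = 1" "has_pv_conjugate u z a" "\<And>x. norm x = 1 \<Longrightarrow> u x = w x"
  shows "has_pv_conjugate w z a"
proof -
  have "continuous_on (sphere 0 1) u \<longleftrightarrow> continuous_on (sphere 0 1) w"
    by (rule continuous_on_cong) (auto simp: assms(3))
  moreover have "u (z * cis (- t)) = w (z * cis (- t))" for t
    by (rule assms(3)) (simp add: norm_mult assms(1))
  ultimately show ?thesis using assms(2) by (simp add: has_pv_conjugate_def)
qed

text \<open>Identities between arguments are later deduced from identities between moduli on the
  circle; uniqueness of the conjugate then rules out any ambiguity by multiples of 2 * pi.\<close>

lemma has_pv_conjugate_unique:
  assumes "has_pv_conjugate u z a" "has_pv_conjugate u z b"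
  shows "a = b"
  using tendsto_unique[OF trivial_limit_at_right_real
      conjunct2[OF assms(1)[unfolded has_pv_conjugate_def]]
      conjunct2[OF assms(2)[unfolded has_pv_conjugate_def]]] .

lemma cot_half_cis:
  assumes "sin (t/2) \<noteq> 0"
  shows "(cis (- t) + 1) / (cis (- t) - 1) = \<i> * complex_of_real (cot (t/2))"
proof -
  define s where "s = t/2"
  have t: "t = 2 * s" and ne: "sin s \<noteq> 0" using assms by (auto simp: s_def)
  have "cis (- t) = cis (- s) * cis (- s)" by (simp add: cis_mult t)
  moreover have "cis s * cis (-s) = 1" by (simp add: cis_mult)
  ultimately have "cis (-t) + 1 = cis (-s) * (cis (-s) + cis s)"
    and "cis (-t) - 1 = cis (-s) * (cis (-s) - cis s)" by (simp_all add: algebra_simps)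
  moreover have "cis (-s) + cis s = of_real (2 * cos s)" "cis (-s) - cis s = - 2 * \<i> * of_real (sin s)"
    by (auto simp: complex_eq_iff)
  moreover have "cis (-s) \<noteq> 0" by simp
  ultimately have "(cis (-t) + 1) / (cis (-t) - 1) = of_real (2 * cos s) / (- 2 * \<i> * of_real (sin s))"
    by (metis nonzero_mult_divide_mult_cancel_left)
  also have "\<dots> = \<i> * complex_of_real (cot (t/2))"
    using ne by (simp add: t cot_def field_simps)
  finally show ?thesis .
qed

text \<open>Mean value property of the holomorphic function
  \<open>\<zeta> \<mapsto> (\<zeta> + z) / (\<zeta> - z) * (f \<zeta> - f z)\<close>, whose factor \<open>(\<zeta> + z) / (\<zeta> - z)\<close> is
  \<open>\<i> * cot (t / 2)\<close> at \<open>\<zeta> = z * cis (- t)\<close>.\<close>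
theorem has_pv_conjugate_Re:
  fixes f :: "complex \<Rightarrow> complex"
  assumes hol: "f holomorphic_on S" and S: "open S" "cball 0 1 \<subseteq> S"
    and im: "Im (f 0) = 0" and z: "norm z = 1"
  shows "has_pv_conjugate (\<lambda>x. Re (f x)) z (2 * pi * Im (f z))"
proof -
  obtain e where e: "e > 0" "(\<Union>x\<in>cball 0 1. ball x e) \<subseteq> S"
    using compact_subset_open_imp_ball_epsilon_subset[OF compact_cball S] by blast
  \<comment> \<open>An open neighbourhood of the closed disc is replaced by a larger disc, whose
    convexity provides primitives.\<close>
  define R where "R = 1 + e"
  have sub: "ball 0 R \<subseteq> S"
  proof
    fix x :: complex assume x: "x \<in> ball 0 R"
    show "x \<in> S"
    proof (cases "norm x \<le> 1")
      case True thus ?thesis using S by auto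
    next
      case False
      have "dist (x / of_real (norm x)) x = norm ((1 / of_real (norm x) - 1) * x)"
        by (simp add: dist_norm algebra_simps)
      also have "\<dots> = norm (1 / complex_of_real (norm x) - 1) * norm x" by (rule norm_mult)
      also have "1 / complex_of_real (norm x) - 1 = of_real (1 / norm x - 1)" by simp
      also have "norm (complex_of_real (1 / norm x - 1)) * norm x = norm x - 1"
        using False by (simp only: norm_of_real) (auto simp: field_simps abs_if)
      also have "\<dots> < e" using x by (simp add: R_def)
      finally have "x \<in> ball (x / of_real (norm x)) e" by simp
      moreover have "x / of_real (norm x) \<in> cball 0 1" using False by (auto simp: norm_divide)
      ultimately show ?thesis using e by blast
    qed
  qed
  have holf: "f holomorphic_on ball 0 R" using hol sub holomorphic_on_subset by blast
  define h where "h = (\<lambda>\<zeta>. if \<zeta> = z then deriv f z else (f \<zeta> - f z) / (\<zeta> - z))"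
  define \<Phi> where "\<Phi> = (\<lambda>\<zeta>. (\<zeta> + z) * h \<zeta>)"
  have h: "h holomorphic_on ball 0 R" unfolding h_def by (rule pole_lemma_open[OF holf]) simp
  have \<Phi>: "\<Phi> holomorphic_on ball 0 R" unfolding \<Phi>_def by (intro holomorphic_intros h)
  \<comment> \<open>On the circle the differential of \<open>\<zeta>\<close> is
    \<open>- \<i> * \<zeta>\<close> dt, so the integral of \<open>\<Phi> - \<Phi> 0\<close> in
    \<open>t\<close> is a multiple of the contour integral of \<open>k\<close>, which vanishes
    because \<open>k\<close> has the primitive \<open>K\<close>.\<close>
  define k where "k = (\<lambda>\<zeta>. if \<zeta> = 0 then deriv \<Phi> 0 else (\<Phi> \<zeta> - \<Phi> 0) / (\<zeta> - 0))"
  have "k holomorphic_on ball 0 R" unfolding k_def by (rule pole_lemma_open[OF \<Phi>]) simp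
  then obtain K where K: "\<And>x. x \<in> ball 0 R \<Longrightarrow> (K has_field_derivative k x) (at x within ball 0 R)"
    using holomorphic_convex_primitive'[OF convex_ball open_ball] by blast
  define \<zeta> where "\<zeta> = (\<lambda>t. z * cis (- t))"
  have \<zeta>1: "norm (\<zeta> t) = 1" for t by (simp add: \<zeta>_def norm_mult z)
  have \<zeta>R: "\<zeta> t \<in> ball 0 R" for t using \<zeta>1 e by (simp add: R_def)
  have \<zeta>0: "\<zeta> t \<noteq> 0" for t using \<zeta>1[of t] by auto
  have "((\<lambda>t. \<zeta> t * (-\<i>) * k (\<zeta> t)) has_integral (K (\<zeta> pi) - K (\<zeta> (-pi)))) {-pi..pi}"
  proof (rule fundamental_theorem_of_calculus)
    fix t
    have "(\<zeta> has_vector_derivative (\<zeta> t * (-\<i>))) (at t within {-pi..pi})"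
      unfolding \<zeta>_def cis_conv_exp
      by (rule derivative_eq_intros has_vector_derivative_real_field | simp)+
    moreover have "(K has_field_derivative k (\<zeta> t)) (at (\<zeta> t) within \<zeta> ` {-pi..pi})"
      by (rule DERIV_subset[OF K[OF \<zeta>R]]) (use \<zeta>R in auto)
    ultimately show "((\<lambda>t. K (\<zeta> t)) has_vector_derivative (\<zeta> t * (-\<i>) * k (\<zeta> t))) (at t within {-pi..pi})"
      by (rule field_vector_diff_chain_within[where f = \<zeta> and g = K, unfolded o_def])
  qed simp
  moreover have "\<zeta> pi = \<zeta> (-pi)" by (simp add: \<zeta>_def complex_eq_iff)
  moreover have "\<zeta> t * (-\<i>) * k (\<zeta> t) = (-\<i>) * (\<Phi> (\<zeta> t) - \<Phi> 0)" for t
    using \<zeta>0[of t] by (simp add: k_def)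
  ultimately have "((\<lambda>t. (-\<i>) * (\<Phi> (\<zeta> t) - \<Phi> 0)) has_integral 0) {-pi..pi}"
    by (simp only: diff_self)
  from has_integral_mult_right[OF this, of \<i>]
  have 1: "((\<lambda>t. \<Phi> (\<zeta> t) - \<Phi> 0) has_integral 0) {-pi..pi}" by simp
  have "((\<lambda>t. \<Phi> 0) has_integral (2 * pi) *\<^sub>R \<Phi> 0) {-pi..pi}"
    using has_integral_const_real[of "\<Phi> 0" "-pi" pi] by simp
  from has_integral_add[OF 1 this]
  have "((\<lambda>t. \<Phi> (\<zeta> t)) has_integral (2 * pi) *\<^sub>R \<Phi> 0) {-pi..pi}" by simp
  from has_integral_linear[OF this bounded_linear_Im]
  have "((\<lambda>t. Im (\<Phi> (\<zeta> t))) has_integral 2 * pi * Im (\<Phi> 0)) {-pi..pi}" by (simp add: o_def)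
  moreover have "\<Phi> 0 = f z - f 0" using z by (auto simp: \<Phi>_def h_def)
  hence "Im (\<Phi> 0) = Im (f z)" using im by simp
  ultimately have int: "((\<lambda>t. Im (\<Phi> (\<zeta> t))) has_integral 2 * pi * Im (f z)) {-pi..pi}" by simp
  define w where "w = (\<lambda>t. Im (\<Phi> (\<zeta> t)))"
  have w: "w t = cot (t/2) * (Re (f (\<zeta> t)) - Re (f z))" if "t \<noteq> 0" "\<bar>t\<bar> \<le> pi" for t
  proof -
    have s: "sin (t/2) \<noteq> 0"
      using that sin_gt_zero[of "t/2"] sin_gt_zero[of "-t/2"] by (cases "t > 0") auto
    have "cis (-t) \<noteq> 1"
    proof
      assume "cis (-t) = 1"
      hence "cos t = 1" by (simp add: complex_eq_iff)
      hence "(sin (t/2))^2 = 0" using cos_double_sin[of "t/2"] by simp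
      thus False using s by simp
    qed
    hence ne: "\<zeta> t \<noteq> z" using z by (auto simp: \<zeta>_def)
    have z0: "z \<noteq> 0" using z by auto
    have "\<Phi> (\<zeta> t) = (\<zeta> t + z) / (\<zeta> t - z) * (f (\<zeta> t) - f z)" using ne by (simp add: \<Phi>_def h_def)
    also have "(\<zeta> t + z) / (\<zeta> t - z) = (z * (cis (-t) + 1)) / (z * (cis (-t) - 1))"
      by (simp add: \<zeta>_def algebra_simps)
    also have "\<dots> = (cis (-t) + 1) / (cis (-t) - 1)" using z0 by simp
    also have "\<dots> = \<i> * complex_of_real (cot (t/2))" by (rule cot_half_cis[OF s])
    finally show ?thesis by (simp add: w_def)
  qed
  have cf: "continuous_on (sphere 0 1) f"
    by (rule continuous_on_subset[OF holomorphic_on_imp_continuous_on[OF holf]])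
       (use e in \<open>auto simp: R_def\<close>)
  have cu: "continuous_on (sphere 0 1) (\<lambda>x. Re (f x))" by (intro continuous_intros cf)
  have wint: "w integrable_on {-pi..pi}" and wI: "integral {-pi..pi} w = 2 * pi * Im (f z)"
    using int unfolding w_def by (auto simp: integral_unique)
  \<comment> \<open>Subtracting \<open>f z\<close> has removed the singularity: \<open>w\<close> is
    integrable across 0, so the principal value is an ordinary integral and the limit is continuity
    of indefinite integrals.\<close>
  have c1: "continuous_on {-pi..pi} (\<lambda>x. integral {-pi..x} w)"
    and c2: "continuous_on {-pi..pi} (\<lambda>x. integral {x..pi} w)"
    using indefinite_integral_continuous_1[OF wint] indefinite_integral_continuous_1'[OF wint] by auto
  have d1: "isCont (\<lambda>x. integral {-pi..x} w) 0" and d2: "isCont (\<lambda>x. integral {x..pi} w) 0"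
    using c1 c2 by (auto intro!: continuous_on_interior simp: interior_atLeastAtMost_real)
  have "((\<lambda>e. integral {-pi..-e} w) \<longlongrightarrow> integral {-pi..0} w) (at_right 0)"
  proof -
    have "((\<lambda>e::real. - e) \<longlongrightarrow> 0) (at_right 0)"
      by (auto intro!: tendsto_eq_intros)
    from isCont_tendsto_compose[OF d1 this] show ?thesis by simp
  qed
  moreover have "((\<lambda>e. integral {e..pi} w) \<longlongrightarrow> integral {0..pi} w) (at_right 0)"
    by (rule isCont_tendsto_compose[OF d2]) (auto intro!: tendsto_eq_intros)
  ultimately have "((\<lambda>e. integral {-pi..-e} w + integral {e..pi} w) \<longlongrightarrow>
      integral {-pi..0} w + integral {0..pi} w) (at_right 0)" by (rule tendsto_add)
  also have "integral {-pi..0} w + integral {0..pi} w = 2 * pi * Im (f z)"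
    using Henstock_Kurzweil_Integration.integral_combine[OF _ _ wint, of 0] wI by simp
  finally have lim: "((\<lambda>e. integral {-pi..-e} w + integral {e..pi} w) \<longlongrightarrow> 2 * pi * Im (f z)) (at_right 0)" .
  have "eventually (\<lambda>e. integral {-pi..-e} w + integral {e..pi} w =
      integral {t. e \<le> \<bar>t\<bar> \<and> \<bar>t\<bar> \<le> pi} (\<lambda>t. cot (t / 2) * Re (f (\<zeta> t)))) (at_right 0)"
    using eventually_small_at_right
  proof eventually_elim
    case (elim e)
    hence e: "0 < e" "e < pi" by auto
    let ?E = "{t. e \<le> \<bar>t\<bar> \<and> \<bar>t\<bar> \<le> pi}"
    have "w integrable_on {-pi..-e}" "w integrable_on {e..pi}"
      using e by (auto intro!: integrable_subinterval_real[OF wint])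
    hence "(w has_integral (integral {-pi..-e} w + integral {e..pi} w)) ?E"
      by (intro punctured_has_integral e) (auto simp: integrable_integral)
    hence "integral {-pi..-e} w + integral {e..pi} w = integral ?E w" by (simp add: integral_unique)
    also have "\<dots> = integral ?E (\<lambda>t. cot (t/2) * Re (f (\<zeta> t)) - cot (t/2) * Re (f z))"
      by (rule integral_cong) (use e in \<open>auto simp: w algebra_simps\<close>)
    also have "\<dots> = integral ?E (\<lambda>t. cot (t/2) * Re (f (\<zeta> t))) - integral ?E (\<lambda>t. cot (t/2) * Re (f z))"
      unfolding \<zeta>_def
      by (rule integral_diff) (intro punctured_integrable e continuous_on_rotate[OF cu z] continuous_intros)+
    also have "integral ?E (\<lambda>t. cot (t/2) * Re (f z)) = 0"
      by (simp add: integral_cot_half_punctured e)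
    finally show ?case by simp
  qed
  from Lim_transform_eventually[OF lim this] cu show ?thesis
    unfolding has_pv_conjugate_def \<zeta>_def by blast
qed

section \<open>Szego polynomials and their arguments\<close>

text \<open>Up to the factors \<open>(1 - |G\<^sub>k|\<^sup>2)\<^sup>-\<^sup>1\<^sup>/\<^sup>2\<close>, the components after \<open>n\<close> steps are the
  polynomials \<open>\<aa>\<^sup>(\<^sup>*\<^sup>)\<close> and \<open>z\<^sup>n\<^sup>-\<^sup>1 \<bb>\<^sup>(\<^sup>*\<^sup>)\<close>.\<close>
primrec szego :: "(nat \<Rightarrow> complex) \<Rightarrow> nat \<Rightarrow> complex \<Rightarrow> complex \<times> complex" where
  "szego g 0 z = (1, 0)"
| "szego g (Suc n) z =
     (fst (szego g n z) + g n * z * snd (szego g n z), z * snd (szego g n z) + cnj (g n) * fst (szego g n z))"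

abbreviation szegoA :: "(nat \<Rightarrow> complex) \<Rightarrow> nat \<Rightarrow> complex \<Rightarrow> complex" where
  "szegoA g n z \<equiv> fst (szego g n z)"

abbreviation szegoB :: "(nat \<Rightarrow> complex) \<Rightarrow> nat \<Rightarrow> complex \<Rightarrow> complex" where
  "szegoB g n z \<equiv> snd (szego g n z)"

lemma holomorphic_szego:
  "(\<lambda>z. szegoA g n z) holomorphic_on S \<and> (\<lambda>z. szegoB g n z) holomorphic_on S"
  by (induction n) (auto intro!: holomorphic_intros)

lemma szegoA_0 [simp]: "szegoA g n 0 = 1"
  by (induction n) auto

text \<open>Up to the factor \<open>1 - (cmod g)\<^sup>2\<close> a step belongs to U(1,1) and
  preserves the form \<open>|a|\<^sup>2 - |w|\<^sup>2\<close>.\<close>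

lemma cmod_hyperbolic_step:
  "(cmod (a + g * w))\<^sup>2 - (cmod (w + cnj g * a))\<^sup>2 = (1 - (cmod g)\<^sup>2) * ((cmod a)\<^sup>2 - (cmod w)\<^sup>2)"
  by (simp add: cmod_power2) (simp add: power2_eq_square algebra_simps)

text \<open>Multiplying the second component by \<open>z\<close> in the closed disc only shrinks it,
  so the hyperbolic form stays positive. In particular \<open>szegoA\<close> has no zeros
  there.\<close>

lemma szego_contractive:
  assumes "\<And>k. cmod (g k) < 1" "norm z \<le> 1"
  shows "cmod (szegoB g n z) < cmod (szegoA g n z)"
proof (induction n)
  case (Suc n)
  have g: "0 < 1 - (cmod (g n))\<^sup>2" using assms(1)[of n] by (simp add: power_less_one_iff)
  have "cmod (z * szegoB g n z) \<le> cmod (szegoB g n z)"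
    using assms(2) by (simp add: norm_mult mult_left_le_one_le)
  with Suc have "cmod (z * szegoB g n z) < cmod (szegoA g n z)" by simp
  hence "0 < (cmod (szegoA g n z))\<^sup>2 - (cmod (z * szegoB g n z))\<^sup>2"
    by (simp add: power_strict_mono)
  with g have "0 < (1 - (cmod (g n))\<^sup>2) * ((cmod (szegoA g n z))\<^sup>2 - (cmod (z * szegoB g n z))\<^sup>2)" by simp
  also have "\<dots> = (cmod (szegoA g (Suc n) z))\<^sup>2 - (cmod (szegoB g (Suc n) z))\<^sup>2"
    using cmod_hyperbolic_step[of "szegoA g n z" "g n" "z * szegoB g n z"] by (simp add: mult.assoc)
  finally show ?case by (simp add: power2_less_imp_less)
qed simp

lemma szegoA_nonzero:
  assumes "\<And>k. cmod (g k) < 1" "norm z \<le> 1"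
  shows "szegoA g n z \<noteq> 0"
  using szego_contractive[of g z n] assms by auto

lemma szego_det_circle:
  assumes "norm z = 1"
  shows "(cmod (szegoA g n z))\<^sup>2 - (cmod (szegoB g n z))\<^sup>2 = (\<Prod>k<n. 1 - (cmod (g k))\<^sup>2)"
proof (induction n)
  case (Suc n)
  show ?case
    using cmod_hyperbolic_step[of "szegoA g n z" "g n" "z * szegoB g n z"] Suc assms
    by (simp add: mult.assoc norm_mult mult.commute[of "prod _ _"])
qed simp

text \<open>The ratio \<open>A\<^sub>n\<^sub>+\<^sub>1 / A\<^sub>n - 1\<close>, whose modulus is below 1 on the closed disc, so that
  the principal logarithms below sum up to a holomorphic logarithm of \<open>A\<^sub>n\<close>.\<close>
definition szego_increment :: "(nat \<Rightarrow> complex) \<Rightarrow> nat \<Rightarrow> complex \<Rightarrow> complex" where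
  "szego_increment g k z = g k * z * szegoB g k z / szegoA g k z"

text \<open>This is the branch of the argument of \<open>szegoA\<close> that is continuous on the
  closed disc and 0 at the origin; it is unbounded in general, unlike the principal argument of the
  product.\<close>

definition szego_arg :: "(nat \<Rightarrow> complex) \<Rightarrow> nat \<Rightarrow> complex \<Rightarrow> real" where
  "szego_arg g n z = (\<Sum>k<n. Im (Ln (1 + szego_increment g k z)))"

lemma norm_szego_increment_less:
  assumes "\<And>k. cmod (g k) < 1" "norm z \<le> 1"
  shows "cmod (szego_increment g k z) < 1"
proof -
  have lt: "cmod (szegoB g k z) < cmod (szegoA g k z)" by (rule szego_contractive) fact+
  have "cmod (g k) * cmod z * cmod (szegoB g k z) \<le> 1 * 1 * cmod (szegoB g k z)"
    using assms(1)[of k] assms(2) by (intro mult_mono) auto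
  with lt have "cmod (g k) * cmod z * cmod (szegoB g k z) < cmod (szegoA g k z)" by simp
  thus ?thesis using lt by (simp add: szego_increment_def norm_mult norm_divide divide_less_eq)
qed

lemma one_plus_not_nonpos: "cmod w < 1 \<Longrightarrow> 1 + w \<notin> \<real>\<^sub>\<le>\<^sub>0"
  using abs_Re_le_cmod[of w] by (auto simp: complex_nonpos_Reals_iff)

lemma has_pv_conjugate_ln_one_plus:
  fixes w :: "complex \<Rightarrow> complex"
  assumes "w holomorphic_on S" "open S" "cball 0 1 \<subseteq> S"
    and w: "\<And>x. norm x \<le> 1 \<Longrightarrow> cmod (w x) < 1" and "w 0 = 0" and z: "norm z = 1"
  shows "has_pv_conjugate (\<lambda>x. ln (cmod (1 + w x))) z (2 * pi * Im (Ln (1 + w z)))"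
proof -
  \<comment> \<open>The bound on \<open>w\<close> is known on the closed disc only; by continuity it
    persists on a neighbourhood, where \<open>1 + w\<close> stays in the right half-plane.\<close>
  define V where "V = S \<inter> (\<lambda>x. cmod (w x)) -` {..<1}"
  have "continuous_on S (\<lambda>x. cmod (w x))"
    using assms by (intro continuous_intros holomorphic_on_imp_continuous_on)
  hence V: "open V" unfolding V_def
    using continuous_open_preimage[OF _ \<open>open S\<close> open_lessThan] by blast
  have sub: "cball 0 1 \<subseteq> V" using assms by (auto simp: V_def)
  have "(\<lambda>x. Ln (1 + w x)) holomorphic_on V"
    by (intro holomorphic_intros holomorphic_on_subset[OF assms(1)])
       (use one_plus_not_nonpos in \<open>auto simp: V_def\<close>)
  hence "has_pv_conjugate (\<lambda>x. Re (Ln (1 + w x))) z (2 * pi * Im (Ln (1 + w z)))"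
    by (rule has_pv_conjugate_Re[OF _ V sub _ z]) (simp add: assms)
  thus ?thesis
  proof (rule has_pv_conjugate_cong[OF z])
    fix x :: complex assume "norm x = 1"
    hence "1 + w x \<noteq> 0" using one_plus_not_nonpos[of "w x"] w[of x] by auto
    thus "Re (Ln (1 + w x)) = ln (cmod (1 + w x))" by simp
  qed
qed

lemma open_szegoA_nonzero: "open {z. szegoA g n z \<noteq> 0}"
proof -
  have "continuous_on UNIV (\<lambda>z. szegoA g n z)"
    using holomorphic_szego holomorphic_on_imp_continuous_on by blast
  thus ?thesis by (intro open_Collect_neq continuous_on_const)
qed

text \<open>\<open>szegoA\<close> is the telescoping product of the factors
  \<open>1 + szego_increment g k\<close>, each of which has a holomorphic principal
  logarithm.\<close>

lemma has_pv_conjugate_ln_szegoA: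
  assumes g: "\<And>k. cmod (g k) < 1" and z: "norm z = 1"
  shows "has_pv_conjugate (\<lambda>x. ln (cmod (szegoA g n x))) z (2 * pi * szego_arg g n z)"
proof -
  have "has_pv_conjugate (\<lambda>x. \<Sum>k<n. ln (cmod (1 + szego_increment g k x))) z
      (\<Sum>k<n. 2 * pi * Im (Ln (1 + szego_increment g k z)))"
  proof (intro has_pv_conjugate_sum z finite_lessThan)
    fix k
    show "has_pv_conjugate (\<lambda>x. ln (cmod (1 + szego_increment g k x))) z
        (2 * pi * Im (Ln (1 + szego_increment g k z)))"
    proof (rule has_pv_conjugate_ln_one_plus[OF _ open_szegoA_nonzero[of g k]])
      show "szego_increment g k holomorphic_on {z. szegoA g k z \<noteq> 0}"
        unfolding szego_increment_def using holomorphic_szego[of g k]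
        by (intro holomorphic_intros) auto
      show "cball 0 1 \<subseteq> {z. szegoA g k z \<noteq> 0}" using szegoA_nonzero[where g = g, OF g] by auto
    qed (auto simp: norm_szego_increment_less g z, simp add: szego_increment_def)
  qed
  also have "(\<Sum>k<n. 2 * pi * Im (Ln (1 + szego_increment g k z))) = 2 * pi * szego_arg g n z"
    by (simp add: szego_arg_def sum_distrib_left)
  finally show ?thesis
  proof (rule has_pv_conjugate_cong[OF z])
    fix x :: complex assume x: "norm x = 1"
    show "(\<Sum>k<n. ln (cmod (1 + szego_increment g k x))) = ln (cmod (szegoA g n x))"
    proof (induction n)
      case (Suc n)
      have A: "szegoA g k x \<noteq> 0" for k using szegoA_nonzero[where g = g, OF g] x by simp
      have eq: "szegoA g (Suc n) x = szegoA g n x * (1 + szego_increment g n x)"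
        using A[of n] by (simp add: szego_increment_def field_simps)
      hence "1 + szego_increment g n x \<noteq> 0" using A[of "Suc n"] by auto
      hence "ln (cmod (szegoA g (Suc n) x)) = ln (cmod (szegoA g n x)) + ln (cmod (1 + szego_increment g n x))"
        using A[of n] by (simp only: eq norm_mult) (rule ln_mult_pos; simp)
      thus ?case using Suc by simp
    qed simp
  qed
qed

lemma cmod_eq_1_cancel:
  assumes "cmod z = 1"
  shows "z * (cnj z * x) = x" "cnj z * (z * x) = x"
proof -
  have "z * cnj z = 1" using assms by (simp add: complex_norm_square[symmetric])
  thus "z * (cnj z * x) = x" "cnj z * (z * x) = x"
    by (metis mult.assoc mult_1, metis mult.assoc mult.commute mult_1)
qed

section \<open>Concatenation and rotation of coefficient sequences\<close>

text \<open>The steps of \<open>h\<close> multiply to a matrix whose second column is the reversal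
  of the first. On the circle reversal is conjugation times \<open>z ^ n\<close>, hence the
  restriction to \<open>norm z = 1\<close>.\<close>

lemma szego_concat:
  assumes z: "norm z = 1" and gh: "\<And>k. k < n \<Longrightarrow> g (p + k) = h k"
  shows "szegoA g (p + n) z = szegoA h n z * szegoA g p z + z ^ n * cnj (szegoB h n z) * szegoB g p z \<and>
         szegoB g (p + n) z = szegoB h n z * szegoA g p z + z ^ n * cnj (szegoA h n z) * szegoB g p z"
  using gh
proof (induction n)
  case (Suc n)
  have IH: "szegoA g (p + n) z = szegoA h n z * szegoA g p z + z ^ n * cnj (szegoB h n z) * szegoB g p z"
      "szegoB g (p + n) z = szegoB h n z * szegoA g p z + z ^ n * cnj (szegoA h n z) * szegoB g p z"
    using Suc by auto
  have gn: "g (p + n) = h n" using Suc.prems by simp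
  show ?case
    by (simp add: IH gn distrib_left distrib_right cmod_eq_1_cancel[OF z])
qed simp

text \<open>The error depends on the new block \<open>h\<close> alone, however long the initial part
  of \<open>g\<close> is; this lets the errors of many blocks be summed.\<close>

lemma szego_arg_concat:
  assumes g: "\<And>k. cmod (g k) < 1" and h: "\<And>k. cmod (h k) < 1"
    and gh: "\<And>k. k < n \<Longrightarrow> g (p + k) = h k" and z: "norm z = 1"
  obtains r where "cmod r \<le> cmod (szegoB h n z) / cmod (szegoA h n z)"
    and "szego_arg g (p + n) z = szego_arg g p z + szego_arg h n z + Im (Ln (1 + r))"
proof -
  \<comment> \<open>A quotient is used because the expression from \<open>szego_concat\<close>
    contains conjugates: it gives the bound on the circle but is not holomorphic. The maximum
    principle then carries \<open>cmod (r x) < 1\<close> into the disc, so that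
    \<open>Ln (1 + r)\<close> is the right branch.\<close>
  define r where "r = (\<lambda>x. szegoA g (p + n) x / (szegoA h n x * szegoA g p x) - 1)"
  define S where "S = {x. szegoA h n x \<noteq> 0} \<inter> {x. szegoA g p x \<noteq> 0}"
  have S: "open S" unfolding S_def by (intro open_Int open_szegoA_nonzero)
  have sub: "cball 0 1 \<subseteq> S" using szegoA_nonzero[where g = g, OF g] szegoA_nonzero[where g = h, OF h] by (auto simp: S_def)
  have hol: "r holomorphic_on S"
    unfolding r_def S_def
    by (intro holomorphic_intros conjunct1[OF holomorphic_szego]) auto
  have r_bound: "cmod (r x) \<le> cmod (szegoB h n x) / cmod (szegoA h n x)" if x: "norm x = 1" for x
  proof -
    have nz: "szegoA h n x \<noteq> 0" "szegoA g p x \<noteq> 0" using szegoA_nonzero[where g = g, OF g] szegoA_nonzero[where g = h, OF h] x by auto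
    have le: "cmod (szegoB g p x) \<le> cmod (szegoA g p x)"
      using szego_contractive[where g = g and n = p and z = x, OF g] x by simp
    have "r x = x ^ n * cnj (szegoB h n x) * szegoB g p x / (szegoA h n x * szegoA g p x)"
      using nz conjunct1[OF szego_concat[where g = g and h = h and p = p and n = n, OF x gh]] by (simp add: r_def field_simps)
    hence "cmod (r x) = cmod (szegoB h n x) / cmod (szegoA h n x) * (cmod (szegoB g p x) / cmod (szegoA g p x))"
      by (simp add: norm_mult norm_divide norm_power x)
    also have "\<dots> \<le> cmod (szegoB h n x) / cmod (szegoA h n x) * 1"
      using le nz by (intro mult_left_mono) (auto simp: divide_le_eq)
    finally show ?thesis by simp
  qed
  have circ: "cmod (r x) < 1" if x: "norm x = 1" for x
  proof -
    have "cmod (szegoB h n x) < cmod (szegoA h n x)" using szego_contractive[where g = h and n = n and z = x, OF h] x by simp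
    hence "cmod (szegoB h n x) / cmod (szegoA h n x) < 1" by (subst divide_less_eq) auto
    with r_bound[OF x] show ?thesis by simp
  qed
  have cont: "continuous_on (cball 0 1) r"
    using continuous_on_subset[OF holomorphic_on_imp_continuous_on[OF hol] sub] .
  have "\<exists>x\<in>sphere (0::complex) 1. \<forall>y\<in>sphere 0 1. cmod (r y) \<le> cmod (r x)"
  proof (rule continuous_attains_sup)
    show "continuous_on (sphere 0 1) (\<lambda>x. cmod (r x))"
      by (intro continuous_intros continuous_on_subset[OF cont]) auto
  qed auto
  then obtain x0 :: complex where x0: "norm x0 = 1" "\<And>y. norm y = 1 \<Longrightarrow> cmod (r y) \<le> cmod (r x0)"
    by auto
  have disc: "cmod (r x) < 1" if x: "norm x \<le> 1" for x
  proof -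
    have "cmod (r x) \<le> cmod (r x0)"
    proof (rule maximum_modulus_frontier[of r "cball 0 1"])
      show "r holomorphic_on interior (cball 0 1)"
        by (rule holomorphic_on_subset[OF hol]) (use sub in auto)
      show "continuous_on (closure (cball 0 1)) r" using cont by simp
    qed (use x x0 in auto)
    with circ[OF x0(1)] show ?thesis by simp
  qed
  have "has_pv_conjugate (\<lambda>x. ln (cmod (1 + r x))) z (2 * pi * Im (Ln (1 + r z)))"
    by (rule has_pv_conjugate_ln_one_plus[OF hol S sub disc _ z]) (auto simp: r_def)
  from has_pv_conjugate_add[OF z has_pv_conjugate_add[OF z has_pv_conjugate_ln_szegoA[where g = g and n = p, OF g z]
        has_pv_conjugate_ln_szegoA[where g = h and n = n, OF h z]] this]
  have "has_pv_conjugate (\<lambda>x. ln (cmod (szegoA g (p + n) x))) z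
      (2 * pi * szego_arg g p z + 2 * pi * szego_arg h n z + 2 * pi * Im (Ln (1 + r z)))"
  proof (rule has_pv_conjugate_cong[OF z])
    fix x :: complex assume x: "norm x = 1"
    have nz: "szegoA h n x \<noteq> 0" "szegoA g p x \<noteq> 0" "szegoA g (p + n) x \<noteq> 0"
      using szegoA_nonzero[where g = g, OF g] szegoA_nonzero[where g = h, OF h] x by auto
    hence "1 + r x \<noteq> 0" by (simp add: r_def)
    moreover have "szegoA g (p + n) x = szegoA g p x * szegoA h n x * (1 + r x)"
      using nz by (simp add: r_def)
    ultimately show "ln (cmod (szegoA g p x)) + ln (cmod (szegoA h n x)) + ln (cmod (1 + r x)) =
        ln (cmod (szegoA g (p + n) x))"
      using nz by (simp add: norm_mult ln_mult_pos)
  qed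
  from has_pv_conjugate_unique[OF this has_pv_conjugate_ln_szegoA[where g = g, OF g z]]
  have "2 * pi * szego_arg g (p + n) z = 2 * pi * (szego_arg g p z + szego_arg h n z + Im (Ln (1 + r z)))"
    by (simp add: algebra_simps)
  hence "szego_arg g (p + n) z = szego_arg g p z + szego_arg h n z + Im (Ln (1 + r z))"
    using pi_gt_zero by simp
  with that r_bound[OF z] show ?thesis by blast
qed

text \<open>Modulating the coefficients moves the evaluation point to 1, so that estimates are
  needed only there. The factor \<open>z\<close> on the left avoids the exponent
  \<open>n - 1\<close>.\<close>

lemma szego_rotate:
  assumes z: "norm z = 1"
  shows "szegoA g n z = szegoA (\<lambda>k. g k * z ^ k) n 1 \<and>
         z * szegoB g n z = z ^ n * szegoB (\<lambda>k. g k * z ^ k) n 1"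
proof (induction n)
  case (Suc n)
  have zz: "z ^ n * cnj z ^ n = 1"
    using z by (simp flip: power_mult_distrib add: complex_norm_square[symmetric])
  hence "z ^ n * (cnj (g n) * cnj z ^ n) = cnj (g n)" by (simp add: mult.left_commute)
  hence e: "z ^ n * (cnj (g n) * (cnj z ^ n * x)) = cnj (g n) * x" for x
    by (metis mult.assoc)
  have IH: "szegoA g n z = szegoA (\<lambda>k. g k * z ^ k) n 1"
    "z * szegoB g n z = z ^ n * szegoB (\<lambda>k. g k * z ^ k) n 1" using Suc by auto
  show ?case
    using IH by (simp add: mult.assoc distrib_left e)
qed simp

lemma szego_increment_rotate:
  assumes "norm z = 1"
  shows "szego_increment g k z = szego_increment (\<lambda>k. g k * z ^ k) k 1"
  using szego_rotate[OF assms, of g k] by (simp add: szego_increment_def mult.assoc)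

lemma szego_arg_rotate:
  assumes "norm z = 1"
  shows "szego_arg g n z = szego_arg (\<lambda>k. g k * z ^ k) n 1"
  by (simp add: szego_arg_def szego_increment_rotate[OF assms])

section \<open>From transfer matrices to Szego polynomials\<close>

lemma nlft_prod_shift_zero:
  assumes "\<And>n. n < 0 \<Longrightarrow> G n = 0" "k \<le> M"
  shows "nlft_prod G z (- int M) k = mat2_id"
  using assms(2)
proof (induction k)
  case (Suc k)
  have "G (- int M + int k) = 0" by (rule assms(1)) (use Suc in auto)
  with Suc show ?case by (simp add: nlft_step_def mat2_mult_def mat2_id_def)
qed simp

text \<open>With the powers of \<open>z\<close> absorbed into \<open>\<gamma>\<close>, a transfer
  step is the Szego step at 1 up to its scalar. The first \<open>M\<close> factors are the identity
  since \<open>G\<close> vanishes at negative indices.\<close>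

lemma nlft_prod_eq_szego:
  assumes G: "\<And>n. n < 0 \<Longrightarrow> G n = 0" and z: "norm z = 1"
  defines "\<gamma> \<equiv> \<lambda>k. G (int k) * z ^ k"
  defines "c \<equiv> \<lambda>k. complex_of_real (\<Prod>j<k. 1 / sqrt (1 - (cmod (G (int j)))\<^sup>2))"
  shows "nlft_prod G z (- int M) (M + k) =
    (c k * cnj (szegoA \<gamma> k 1), c k * szegoB \<gamma> k 1, c k * cnj (szegoB \<gamma> k 1), c k * szegoA \<gamma> k 1)"
proof (induction k)
  case 0
  show ?case using nlft_prod_shift_zero[where G = G and k = M and M = M and z = z, OF G] by (simp add: mat2_id_def c_def)
next
  case (Suc k)
  have "inverse z = cnj z" using z
    by (metis complex_norm_square inverse_unique of_real_1 power_one)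
  hence e: "z powi (- int k) = cnj z ^ k" by (simp add: power_int_minus flip: power_inverse)
  show ?case
    by (simp add: Suc nlft_step_def mat2_mult_def e Let_def)
       (simp add: c_def \<gamma>_def algebra_simps)
qed

lemma szego_eventually_const:
  assumes "\<And>k. n \<le> k \<Longrightarrow> g k = 0" "n \<le> m"
  shows "szegoA g m 1 = szegoA g n 1 \<and> szegoB g m 1 = szegoB g n 1"
  using assms(2) by (induction m rule: dec_induct) (auto simp: assms(1))

text \<open>The determinant identity turns \<open>1 + |\<bb>|\<^sup>2\<close> into
  \<open>|A|\<^sup>2 / C\<close> on the circle. The constant has conjugate 0, and the factor 4 * pi
  from the square and the normalisation cancels.\<close>

lemma arg_a_star_eq_szego_arg:
  assumes F0: "\<And>n. n < 0 \<Longrightarrow> F n = 0" and F1: "\<And>n. cmod (F n) < 1" and z: "norm z = 1"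
  shows "arg_a_star (trunc N F) z = szego_arg (\<lambda>k. F (int k)) (Suc N) z"
proof -
  define G where "G = trunc N F"
  define M where "M = supp_bound G"
  define g where "g = (\<lambda>k. G (int k))"
  have G0: "n < 0 \<Longrightarrow> G n = 0" for n using F0 by (simp add: G_def trunc_def)
  have g1: "cmod (g k) < 1" for k using F1 by (simp add: g_def G_def trunc_def)
  have "\<forall>n. int N < \<bar>n\<bar> \<longrightarrow> G n = 0" by (simp add: G_def trunc_def)
  from LeastI[where P = "\<lambda>M. \<forall>n. int M < \<bar>n\<bar> \<longrightarrow> G n = 0", OF this]
    Least_le[where P = "\<lambda>M. \<forall>n. int M < \<bar>n\<bar> \<longrightarrow> G n = 0", OF this]
  have GM: "\<forall>n. int M < \<bar>n\<bar> \<longrightarrow> G n = 0" and "M \<le> N"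
    unfolding M_def supp_bound_def .
  define C where "C = (\<Prod>k<Suc M. 1 - (cmod (g k))\<^sup>2)"
  have "0 < 1 - (cmod (g k))\<^sup>2" for k using g1[of k] by (simp add: power_less_one_iff)
  hence C: "C > 0" unfolding C_def by (intro prod_pos) auto
  have key: "ln (1 + (cmod (nlft_b G x))\<^sup>2) = - ln C + 2 * ln (cmod (szegoA g (Suc N) x))"
    if x: "norm x = 1" for x
  proof -
    define \<gamma> where "\<gamma> = (\<lambda>k. g k * x ^ k)"
    define c where "c = (\<Prod>k<Suc M. 1 / sqrt (1 - (cmod (g k))\<^sup>2))"
    have nb: "nlft_b G x = of_real c * cnj (szegoB \<gamma> (Suc M) 1)"
      using nlft_prod_eq_szego[where M = M and k = "Suc M" and G = G and z = x, OF G0 x]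
      by (simp add: nlft_b_def Let_def M_def[symmetric] mat2_21_def c_def g_def \<gamma>_def mult_2 del: prod.lessThan_Suc szego.simps nlft_prod.simps)
    have "(1 / sqrt (1 - (cmod (g k))\<^sup>2))\<^sup>2 = 1 / (1 - (cmod (g k))\<^sup>2)" for k
      using g1[of k] by (simp add: power_divide power_le_one)
    hence c2: "c\<^sup>2 = 1 / C" unfolding c_def C_def prod_power_distrib
      by (simp add: prod_dividef del: prod.lessThan_Suc)
    have det: "(cmod (szegoA \<gamma> (Suc M) 1))\<^sup>2 - (cmod (szegoB \<gamma> (Suc M) 1))\<^sup>2 = C"
      using szego_det_circle[of 1 \<gamma> "Suc M"]
      by (simp add: C_def \<gamma>_def norm_mult norm_power x del: prod.lessThan_Suc szego.simps)
    have "1 + (cmod (nlft_b G x))\<^sup>2 = 1 + (cmod (szegoB \<gamma> (Suc M) 1))\<^sup>2 / C"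
      using c2 by (simp add: nb norm_mult power_mult_distrib del: szego.simps)
    also have "\<dots> = (cmod (szegoA \<gamma> (Suc M) 1))\<^sup>2 / C" using det C by (simp add: field_simps del: szego.simps)
    \<comment> \<open>\<open>supp_bound\<close> is a least bound and may lie below \<open>N\<close>;
      the steps in between have coefficient 0.\<close>
    also have "szegoA \<gamma> (Suc M) 1 = szegoA \<gamma> (Suc N) 1"
      using szego_eventually_const[of "Suc M" \<gamma> "Suc N"] GM \<open>M \<le> N\<close> by (simp add: \<gamma>_def g_def del: szego.simps)
    also have "\<dots> = szegoA g (Suc N) x" using szego_rotate[OF x, of g "Suc N"] unfolding \<gamma>_def by simp
    finally have "1 + (cmod (nlft_b G x))\<^sup>2 = (cmod (szegoA g (Suc N) x))\<^sup>2 / C" .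
    moreover have "szegoA g (Suc N) x \<noteq> 0" by (rule szegoA_nonzero[where g = g, OF g1]) (simp add: x)
    ultimately show ?thesis using C by (simp add: ln_div ln_realpow del: szego.simps)
  qed
  have "has_pv_conjugate (\<lambda>x. - ln C + 2 * ln (cmod (szegoA g (Suc N) x))) z
     (0 + 2 * (2 * pi * szego_arg g (Suc N) z))"
    by (rule has_pv_conjugate_add[OF z has_pv_conjugate_const has_pv_conjugate_cmult[OF
          has_pv_conjugate_ln_szegoA[where g = g, OF g1 z]]])
  from has_pv_conjugate_cong[OF z this key[symmetric]]
  have "has_pv_conjugate (\<lambda>x. ln (1 + (cmod (nlft_b G x))\<^sup>2)) z (4 * pi * szego_arg g (Suc N) z)"
    by (simp add: mult.assoc del: szego.simps)
  hence lim: "((\<lambda>\<epsilon>. integral {t. \<epsilon> \<le> \<bar>t\<bar> \<and> \<bar>t\<bar> \<le> pi}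
      (\<lambda>t. cot (t / 2) * ln (1 + (cmod (nlft_b G (z * cis (- t))))\<^sup>2)))
       \<longlongrightarrow> 4 * pi * szego_arg g (Suc N) z) (at_right 0)"
    unfolding has_pv_conjugate_def by (rule conjunct2)
  have "cis (Arg z - t) = z * cis (- t)" for t
  proof -
    have "cis (Arg z) = z" using rcis_cmod_Arg[of z] z by (simp add: rcis_def)
    thus ?thesis using cis_mult[of "Arg z" "- t"] by simp
  qed
  hence "arg_a_star G z = 1 / (4 * pi) * (4 * pi * szego_arg g (Suc N) z)"
    unfolding arg_a_star_def Let_def using tendsto_Lim[OF trivial_limit_at_right_real lim] by (simp only:)
  hence "arg_a_star G z = szego_arg g (Suc N) z" by simp
  also have "\<dots> = szego_arg (\<lambda>k. F (int k)) (Suc N) z"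
  proof -
    have "szego g k z = szego (\<lambda>k. F (int k)) k z" if "k \<le> Suc N" for k
      using that by (induction k) (auto simp: g_def G_def trunc_def)
    thus ?thesis unfolding szego_arg_def szego_increment_def
      by (intro sum.cong) (auto simp: g_def G_def trunc_def)
  qed
  finally show ?thesis by (simp add: G_def)
qed

section \<open>Perturbation of the linear Fourier transform\<close>

text \<open>Summation by parts replaces \<open>B\<close> by the conjugate of the linear partial sum \<open>L\<close>; every
  correction carries two factors bounded by \<open>l\<close>, and that makes it summable over all blocks.\<close>
lemma szego_perturbation:
  fixes \<gamma> :: "nat \<Rightarrow> complex" and D :: nat and s l :: real
  defines "L \<equiv> \<lambda>n. \<Sum>k<n. \<gamma> k"
  assumes s: "(\<Sum>k<D. cmod (\<gamma> k)) \<le> s" "s \<le> 1/4"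
    and l: "\<And>n. n \<le> D \<Longrightarrow> cmod (L n) \<le> l" "l \<le> 1/4"
  shows "\<bar>szego_arg \<gamma> D 1 - Im (\<Sum>k<D. \<gamma> k * cnj (L k))\<bar> \<le> 90 * s\<^sup>2 * l\<^sup>2"
    and "cmod (szegoB \<gamma> D 1) / cmod (szegoA \<gamma> D 1) \<le> 3 * cmod (L D) + 6 * l\<^sup>2 * s"
proof -
  define A where "A = (\<lambda>n. szegoA \<gamma> n 1)"
  define B where "B = (\<lambda>n. szegoB \<gamma> n 1)"
  have A0: "A 0 = 1" and B0: "B 0 = 0"
    and AS: "A (Suc n) = A n + \<gamma> n * B n" and BS: "B (Suc n) = B n + cnj (\<gamma> n) * A n" for n
    by (simp_all add: A_def B_def)
  have LS: "L (Suc n) = L n + \<gamma> n" for n by (simp add: L_def)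
  have L0: "L 0 = 0" by (simp add: L_def)
  define u where "u = (\<lambda>n. \<Sum>k<n. cmod (\<gamma> k))"
  have u0: "0 \<le> u n" for n by (simp add: u_def sum_nonneg)
  have us: "u n \<le> s" if "n \<le> D" for n
  proof -
    have "u n \<le> u D" unfolding u_def using that by (intro sum_mono2) auto
    with s show ?thesis by (simp add: u_def)
  qed
  have s0: "0 \<le> s" using u0[of D] us[of D] by simp
  have l0: "0 \<le> l" using l(1)[of 0] by (simp add: L0)
  have g_le: "cmod (\<gamma> k) \<le> s" if "k < D" for k
    using us[of "Suc k"] u0[of k] that by (simp add: u_def)
  \<comment> \<open>First round of a bootstrap: a bound without \<open>l\<close> gives 3/2 for both
    components. Inserted into \<open>Bsum\<close> it yields the bound \<open>3 * l\<close> for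
    \<open>B\<close>, which is then fed into the same correction term again.\<close>
  have crude: "cmod (A n) + cmod (B n) \<le> 1 + 2 * u n" if "n \<le> D" for n
    using that
  proof (induction n)
    case (Suc n)
    have "cmod (A (Suc n)) + cmod (B (Suc n)) \<le> (cmod (A n) + cmod (\<gamma> n) * cmod (B n)) + (cmod (B n) + cmod (\<gamma> n) * cmod (A n))"
      unfolding AS BS by (intro add_mono norm_triangle_le) (simp_all add: norm_mult)
    also have "\<dots> = (1 + cmod (\<gamma> n)) * (cmod (A n) + cmod (B n))" by (simp add: algebra_simps)
    also have "\<dots> \<le> (1 + cmod (\<gamma> n)) * (1 + 2 * u n)" using Suc by (intro mult_left_mono) auto
    also have "\<dots> = 1 + 2 * u n + cmod (\<gamma> n) * (1 + 2 * u n)" by (simp add: algebra_simps)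
    also have "cmod (\<gamma> n) * (1 + 2 * u n) \<le> cmod (\<gamma> n) * 2"
      using us[of n] Suc.prems s(2) by (intro mult_left_mono) auto
    finally show ?case by (simp add: u_def)
  qed (simp add: A0 B0 u_def)
  have A32: "cmod (A n) \<le> 3/2" and B32: "cmod (B n) \<le> 3/2" if "n \<le> D" for n
    using crude[OF that] us[OF that] s(2) norm_ge_zero[of "A n"] norm_ge_zero[of "B n"] by linarith+
  \<comment> \<open>Exact summation by parts: the leading term is \<open>cnj (L n)\<close>, and the
    remainder pairs \<open>L\<close> with \<open>B\<close>, so that it is of second order in
    \<open>l\<close>.\<close>
  have Bsum: "B n = cnj (L n) * A n - (\<Sum>k<n. cnj (L (Suc k)) * (\<gamma> k * B k))" for n
    by (induction n) (simp_all add: A0 B0 L0 AS BS LS algebra_simps)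
  have corr: "cmod (\<Sum>k<n. cnj (L (Suc k)) * (\<gamma> k * B k)) \<le> l * s * b"
    if "n \<le> D" "\<And>k. k < n \<Longrightarrow> cmod (B k) \<le> b" "0 \<le> b" for n b
  proof -
    have "cmod (\<Sum>k<n. cnj (L (Suc k)) * (\<gamma> k * B k)) \<le> (\<Sum>k<n. l * (cmod (\<gamma> k) * b))"
    proof (rule sum_norm_le)
      fix k assume "k \<in> {..<n}"
      thus "cmod (cnj (L (Suc k)) * (\<gamma> k * B k)) \<le> l * (cmod (\<gamma> k) * b)"
        unfolding norm_mult complex_mod_cnj using that l l0 by (intro mult_mono) auto
    qed
    also have "\<dots> = l * (u n * b)" by (simp add: u_def sum_distrib_left sum_distrib_right)
    also have "\<dots> \<le> l * (s * b)" using us[OF that(1)] l0 that by (intro mult_left_mono mult_right_mono) auto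
    finally show ?thesis by (simp add: mult.assoc)
  qed
  have B3: "cmod (B n) \<le> 3 * l" if n: "n \<le> D" for n
  proof -
    have "cmod (B n) \<le> cmod (cnj (L n) * A n) + l * s * (3/2)"
      unfolding Bsum[of n] by (rule order_trans[OF norm_triangle_ineq4]) (use corr[of n "3/2"] B32 n in auto)
    also have "cmod (cnj (L n) * A n) \<le> l * (3/2)"
      unfolding norm_mult complex_mod_cnj using l(1)[OF n] A32[OF n] l0 by (intro mult_mono) auto
    also have "l * s * (3/2) \<le> l * (1/4) * (3/2)" using l0 s(2) by (intro mult_right_mono mult_left_mono) auto
    finally show ?thesis using l0 by simp
  qed
  have Asum: "A n = 1 + (\<Sum>k<n. \<gamma> k * B k)" for n by (induction n) (simp_all add: A0 AS)
  have A1: "cmod (A n - 1) \<le> 3 * l * s" if n: "n \<le> D" for n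
  proof -
    have "cmod (A n - 1) \<le> (\<Sum>k<n. cmod (\<gamma> k) * (3 * l))"
      unfolding Asum[of n] add_diff_cancel_left' using n B3
      by (intro sum_norm_le) (auto simp: norm_mult intro!: mult_left_mono)
    also have "\<dots> = 3 * l * u n" by (simp add: u_def sum_distrib_left mult.commute)
    also have "\<dots> \<le> 3 * l * s" using us[OF n] l0 by (intro mult_left_mono) auto
    finally show ?thesis .
  qed
  have ls: "l * s \<le> 1/4 * (1/4)" using l0 s0 l(2) s(2) by (intro mult_mono) auto
  have Ahalf: "1/2 \<le> cmod (A n)" if n: "n \<le> D" for n
    using A1[OF n] ls norm_triangle_ineq2[of 1 "1 - A n"] by (simp add: norm_minus_commute)
  have corr': "cmod (\<Sum>k<n. cnj (L (Suc k)) * (\<gamma> k * B k)) \<le> 3 * l\<^sup>2 * s" if n: "n \<le> D" for n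
    using corr[of n "3 * l"] B3 n l0 by (simp add: power2_eq_square mult_ac)
  have BL: "cmod (B n - cnj (L n)) \<le> 6 * l\<^sup>2 * s" if n: "n \<le> D" for n
  proof -
    have "B n - cnj (L n) = cnj (L n) * (A n - 1) - (\<Sum>k<n. cnj (L (Suc k)) * (\<gamma> k * B k))"
      unfolding Bsum[of n] by (simp add: algebra_simps)
    also have "cmod \<dots> \<le> cmod (cnj (L n) * (A n - 1)) + 3 * l\<^sup>2 * s"
      by (rule order_trans[OF norm_triangle_ineq4]) (use corr'[OF n] in auto)
    also have "cmod (cnj (L n) * (A n - 1)) \<le> l * (3 * l * s)"
      unfolding norm_mult complex_mod_cnj using l(1)[OF n] A1[OF n] l0 by (intro mult_mono) auto
    finally show ?thesis by (simp add: power2_eq_square algebra_simps)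
  qed
  define T where "T = (\<lambda>k. szego_increment \<gamma> k 1)"
  have T: "T k = \<gamma> k * B k / A k" for k by (simp add: T_def szego_increment_def A_def B_def)
  have div2: "x / cmod (A k) \<le> 2 * x" if "k \<le> D" "0 \<le> x" for x k
  proof -
    have "x / cmod (A k) \<le> x / (1/2)" using Ahalf[OF that(1)] that(2) by (intro divide_left_mono) auto
    thus ?thesis by simp
  qed
  have T1: "cmod (T k) \<le> 6 * l * cmod (\<gamma> k)" if k: "k < D" for k
  proof -
    have "cmod (T k) \<le> 2 * (cmod (\<gamma> k) * cmod (B k))"
      unfolding T norm_divide norm_mult using k by (intro div2) auto
    also have "cmod (\<gamma> k) * cmod (B k) \<le> cmod (\<gamma> k) * (3 * l)" using B3 k by (intro mult_left_mono) auto
    finally show ?thesis by (simp add: algebra_simps)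
  qed
  have T2: "cmod (T k - \<gamma> k * cnj (L k)) \<le> 18 * l\<^sup>2 * s * cmod (\<gamma> k)" if k: "k < D" for k
  proof -
    have "A k \<noteq> 0" using Ahalf[of k] k by auto
    hence "T k - \<gamma> k * cnj (L k) = \<gamma> k * ((B k - cnj (L k)) + cnj (L k) * (1 - A k)) / A k"
      unfolding T by (simp add: field_simps)
    hence "cmod (T k - \<gamma> k * cnj (L k)) \<le> 2 * (cmod (\<gamma> k) * cmod ((B k - cnj (L k)) + cnj (L k) * (1 - A k)))"
      using k by (simp only: norm_divide norm_mult) (intro div2, auto)
    moreover have "cmod ((B k - cnj (L k)) + cnj (L k) * (1 - A k)) \<le> 6 * l\<^sup>2 * s + l * (3 * l * s)"
    proof (rule norm_triangle_mono)
      show "cmod (cnj (L k) * (1 - A k)) \<le> l * (3 * l * s)"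
        unfolding norm_mult complex_mod_cnj using l(1)[of k] A1[of k] l0 k
        by (intro mult_mono) (auto simp: norm_minus_commute)
    qed (use BL k in auto)
    from mult_left_mono[OF this norm_ge_zero[of "\<gamma> k"]]
    have "cmod (\<gamma> k) * cmod ((B k - cnj (L k)) + cnj (L k) * (1 - A k)) \<le> 9 * l\<^sup>2 * s * cmod (\<gamma> k)"
      by (simp add: power2_eq_square algebra_simps)
    ultimately show ?thesis by linarith
  qed
  have T3: "cmod (Ln (1 + T k) - T k) \<le> 72 * l\<^sup>2 * s * cmod (\<gamma> k)" if k: "k < D" for k
  proof -
    have "6 * l * cmod (\<gamma> k) \<le> 6 * (1/4) * (1/4)"
      using l0 l(2) g_le[OF k] s(2) by (intro mult_mono) auto
    hence half: "cmod (T k) \<le> 1/2" using T1[OF k] by simp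
    hence "cmod (Ln (1 + T k) - T k) \<le> (cmod (T k))\<^sup>2 / (1 - cmod (T k))" by (intro Ln_approx_linear) simp
    also have "\<dots> \<le> (cmod (T k))\<^sup>2 / (1/2)" using half by (intro divide_left_mono) auto
    also have "\<dots> = 2 * (cmod (T k))\<^sup>2" by simp
    also have "(cmod (T k))\<^sup>2 \<le> (6 * l * cmod (\<gamma> k))\<^sup>2" using T1[OF k] by (intro power_mono) auto
    also have "(6 * l * cmod (\<gamma> k))\<^sup>2 = 36 * l\<^sup>2 * cmod (\<gamma> k) * cmod (\<gamma> k)" by (simp add: power2_eq_square)
    also have "\<dots> \<le> 36 * l\<^sup>2 * s * cmod (\<gamma> k)"
      using g_le[OF k] by (intro mult_right_mono mult_left_mono) auto
    finally show ?thesis by simp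
  qed
  have "\<bar>szego_arg \<gamma> D 1 - Im (\<Sum>k<D. \<gamma> k * cnj (L k))\<bar> = \<bar>\<Sum>k<D. Im (Ln (1 + T k) - \<gamma> k * cnj (L k))\<bar>"
    by (simp add: szego_arg_def T_def sum_subtractf Im_sum)
  also have "\<dots> \<le> (\<Sum>k<D. 90 * l\<^sup>2 * s * cmod (\<gamma> k))"
  proof (rule order_trans[OF sum_abs], rule sum_mono)
    fix k assume "k \<in> {..<D}"
    hence k: "k < D" by simp
    have "\<bar>Im (Ln (1 + T k) - \<gamma> k * cnj (L k))\<bar> \<le> cmod (Ln (1 + T k) - \<gamma> k * cnj (L k))" by (rule abs_Im_le_cmod)
    also have "\<dots> = cmod ((Ln (1 + T k) - T k) + (T k - \<gamma> k * cnj (L k)))" by simp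
    also have "\<dots> \<le> 72 * l\<^sup>2 * s * cmod (\<gamma> k) + 18 * l\<^sup>2 * s * cmod (\<gamma> k)"
      by (rule norm_triangle_mono[OF T3[OF k] T2[OF k]])
    finally show "\<bar>Im (Ln (1 + T k) - \<gamma> k * cnj (L k))\<bar> \<le> 90 * l\<^sup>2 * s * cmod (\<gamma> k)" by linarith
  qed
  also have "\<dots> = 90 * l\<^sup>2 * s * u D" by (simp add: u_def sum_distrib_left)
  also have "\<dots> \<le> 90 * l\<^sup>2 * s * s" using us[of D] s0 by (intro mult_left_mono) auto
  finally show "\<bar>szego_arg \<gamma> D 1 - Im (\<Sum>k<D. \<gamma> k * cnj (L k))\<bar> \<le> 90 * s\<^sup>2 * l\<^sup>2"
    by (simp add: power2_eq_square mult_ac)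
  \<comment> \<open>\<open>L D\<close> is not replaced by \<open>l\<close>: over a full tent it is
    of second order in 1 / m, while \<open>l\<close> is only of first order.\<close>
  have "cmod (B D) \<le> cmod (cnj (L D) * A D) + 3 * l\<^sup>2 * s"
    unfolding Bsum[of D] by (rule order_trans[OF norm_triangle_ineq4]) (use corr'[of D] in auto)
  also have "cmod (cnj (L D) * A D) \<le> cmod (L D) * (3/2)"
    unfolding norm_mult complex_mod_cnj using A32[of D] by (intro mult_left_mono) auto
  finally have "2 * cmod (B D) \<le> 3 * cmod (L D) + 6 * l\<^sup>2 * s" by simp
  with div2[of D "cmod (B D)"] show "cmod (szegoB \<gamma> D 1) / cmod (szegoA \<gamma> D 1) \<le> 3 * cmod (L D) + 6 * l\<^sup>2 * s"
    by (simp add: A_def B_def)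
qed

text \<open>Summation by parts again: the diagonal \<open>\<Sum>(G n)\<^sup>2\<close> splits off with the factor
  \<open>-1 / (1 - cnj y)\<close>, of imaginary part \<open>cot (d/2) / 2\<close> for \<open>y = cis d\<close>.\<close>
lemma autocorrelation_estimate:
  fixes G :: "nat \<Rightarrow> real" and y :: complex and D :: nat
  defines "L \<equiv> \<lambda>n. \<Sum>k<n. of_real (G k) * y ^ k"
  assumes y: "norm y = 1" "y \<noteq> 1" and G0: "G 0 = 0" and G: "\<And>k. \<bar>G k\<bar> \<le> \<delta>"
    and \<eta>: "\<And>k. \<bar>G (Suc k) - G k\<bar> \<le> \<eta>" "real D * \<eta> \<le> 2 * \<delta>"
  shows "\<And>n. n \<le> D \<Longrightarrow> cmod (L n) \<le> 3 * \<delta> / cmod (1 - y)"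
    and "cmod ((\<Sum>k<D. of_real (G k) * y ^ k * cnj (L k)) + of_real (\<Sum>k<D. (G k)\<^sup>2) / (1 - cnj y))
      \<le> 12 * \<delta>\<^sup>2 / (cmod (1 - y))\<^sup>2"
proof -
  \<comment> \<open>\<open>V\<close> sums the increments of \<open>G\<close>;
    \<open>(1 - y) * L n\<close> differs from it by one boundary term, which gains a factor
    \<open>1 / |1 - y|\<close>.\<close>
  define V where "V = (\<lambda>n. \<Sum>k<n. complex_of_real (G (Suc k) - G k) * y ^ Suc k)"
  define x where "x = cmod (1 - y)"
  have x: "x > 0" using y by (simp add: x_def)
  have LS: "L (Suc n) = L n + of_real (G n) * y ^ n" for n by (simp add: L_def)
  have VS: "V (Suc n) = V n + (of_real (G (Suc n)) - of_real (G n)) * y ^ Suc n" for n by (simp add: V_def)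
  have LV: "(1 - y) * L n = V n - of_real (G n) * y ^ n" for n
  proof (induction n)
    case (Suc n)
    have "(1 - y) * L (Suc n) = (1 - y) * L n + (1 - y) * (of_real (G n) * y ^ n)"
      by (simp only: LS distrib_left)
    also have "\<dots> = V n - of_real (G n) * y ^ n + (1 - y) * (of_real (G n) * y ^ n)" by (simp only: Suc)
    finally show ?case unfolding VS by (simp add: algebra_simps)
  qed (simp add: L_def V_def G0)
  have \<eta>0: "0 \<le> \<eta>" using \<eta>(1)[of 0] by linarith
  have \<delta>0: "0 \<le> \<delta>" using G[of 0] by linarith
  have n\<eta>: "real n * \<eta> \<le> 2 * \<delta>" if "n \<le> D" for n
    using mult_right_mono[of "real n" "real D" \<eta>] that \<eta>0 \<eta>(2) by simp
  have V: "cmod (V n) \<le> 2 * \<delta>" if "n \<le> D" for n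
  proof -
    have "cmod (V n) \<le> (\<Sum>k<n. \<eta>)" unfolding V_def
      by (intro sum_norm_le) (simp add: norm_mult norm_power y \<eta>(1) del: of_real_diff power_Suc)
    thus ?thesis using n\<eta>[OF that] by simp
  qed
  show L: "cmod (L n) \<le> 3 * \<delta> / cmod (1 - y)" if "n \<le> D" for n
  proof -
    have "x * cmod (L n) = cmod (V n - of_real (G n) * y ^ n)" by (simp add: x_def flip: norm_mult LV)
    also have "\<dots> \<le> 2 * \<delta> + \<delta>"
      by (rule order_trans[OF norm_triangle_ineq4])
         (use V[OF that] G[of n] in \<open>simp add: norm_mult norm_power y\<close>)
    finally show ?thesis using x by (simp add: x_def field_simps)
  qed
  define l where "l = 3 * \<delta> / x"
  have l0: "0 \<le> l" using \<delta>0 x by (simp add: l_def)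
  have abel: "(\<Sum>k<n. of_real (G k) * y ^ k * cnj (V k)) =
      L n * cnj (V n) - (\<Sum>k<n. L (Suc k) * cnj (V (Suc k) - V k))" for n
    by (induction n) (simp_all add: L_def V_def algebra_simps)
  have Vdiff: "cmod (V (Suc k) - V k) \<le> \<eta>" for k
    using \<eta>(1)[of k] by (simp add: V_def norm_mult norm_power y del: of_real_diff power_Suc)
  \<comment> \<open>Moving the differences onto \<open>V\<close> costs \<open>\<eta>\<close> per
    index, in total at most \<open>2 * \<delta>\<close>; the boundary term contributes another
    \<open>2 * \<delta> * l\<close>.\<close>
  have E: "cmod (\<Sum>k<D. of_real (G k) * y ^ k * cnj (V k)) \<le> 4 * \<delta> * l"
  proof -
    have "cmod (L D * cnj (V D)) \<le> l * (2 * \<delta>)"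
      unfolding norm_mult complex_mod_cnj using L[of D] V[of D] l0 by (intro mult_mono) (auto simp: l_def x_def)
    moreover have "cmod (\<Sum>k<D. L (Suc k) * cnj (V (Suc k) - V k)) \<le> (\<Sum>k<D. l * \<eta>)"
      unfolding l_def x_def
      by (intro sum_norm_le, unfold norm_mult complex_mod_cnj, intro mult_mono)
         (use L Vdiff l0 in \<open>auto simp: l_def x_def\<close>)
    moreover have "(\<Sum>k<D. l * \<eta>) \<le> l * (2 * \<delta>)"
      using mult_left_mono[OF n\<eta>[of D] l0] by (simp add: mult_ac)
    ultimately show ?thesis unfolding abel
      by (intro order_trans[OF norm_triangle_ineq4]) (simp add: algebra_simps)
  qed
  have yy: "of_real (G k) * y ^ k * cnj (of_real (G k) * y ^ k) = of_real ((G k)\<^sup>2)" for k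
    unfolding complex_norm_square[symmetric] by (simp add: norm_mult norm_power y)
  have ne: "1 - cnj y \<noteq> 0" using y by (metis complex_cnj_cnj complex_cnj_one eq_iff_diff_eq_0)
  have "(1 - cnj y) * (of_real (G k) * y ^ k * cnj (L k)) =
      of_real (G k) * y ^ k * cnj (V k) - of_real ((G k)\<^sup>2)" for k
  proof -
    have "(1 - cnj y) * cnj (L k) = cnj (V k) - cnj (of_real (G k) * y ^ k)"
      using arg_cong[OF LV[of k], of cnj] by simp
    hence "(1 - cnj y) * (of_real (G k) * y ^ k * cnj (L k)) =
        of_real (G k) * y ^ k * (cnj (V k) - cnj (of_real (G k) * y ^ k))"
      by (metis mult.left_commute)
    thus ?thesis by (simp only: right_diff_distrib yy)
  qed
  hence "(1 - cnj y) * (\<Sum>k<D. of_real (G k) * y ^ k * cnj (L k)) =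
      (\<Sum>k<D. of_real (G k) * y ^ k * cnj (V k)) - of_real (\<Sum>k<D. (G k)\<^sup>2)"
    by (simp only: sum_distrib_left sum_subtractf of_real_sum)
  hence "(\<Sum>k<D. of_real (G k) * y ^ k * cnj (L k)) + of_real (\<Sum>k<D. (G k)\<^sup>2) / (1 - cnj y) =
      (\<Sum>k<D. of_real (G k) * y ^ k * cnj (V k)) / (1 - cnj y)"
    using ne by (simp add: field_simps)
  also have "cmod \<dots> = cmod (\<Sum>k<D. of_real (G k) * y ^ k * cnj (V k)) / x"
  proof -
    have "cmod (1 - cnj y) = x" unfolding x_def by (metis complex_cnj_diff complex_cnj_one complex_mod_cnj)
    thus ?thesis by (simp add: norm_divide)
  qed
  also have "\<dots> \<le> 4 * \<delta> * l / x" using E x by (intro divide_right_mono) auto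
  finally show "cmod ((\<Sum>k<D. of_real (G k) * y ^ k * cnj (L k)) + of_real (\<Sum>k<D. (G k)\<^sup>2) / (1 - cnj y))
      \<le> 12 * \<delta>\<^sup>2 / (cmod (1 - y))\<^sup>2"
    by (simp add: l_def x_def power2_eq_square)
qed

section \<open>Tent-shaped blocks\<close>

text \<open>Natural subtraction makes it vanish from \<open>2 * J\<close> on. The linear flanks make
  its transform a squared Dirichlet kernel, with quadratic decay away from the centre.\<close>

definition tent :: "nat \<Rightarrow> real \<Rightarrow> nat \<Rightarrow> real" where
  "tent J \<delta> k = \<delta> / real J * real (min k (2 * J - k))"

lemma tent_nonneg: "0 \<le> \<delta> \<Longrightarrow> 0 \<le> tent J \<delta> k"
  by (simp add: tent_def)

lemma tent_le:
  assumes "0 \<le> \<delta>"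
  shows "tent J \<delta> k \<le> \<delta>"
proof (cases "J = 0")
  case False
  have "min k (2 * J - k) \<le> J" by linarith
  hence "real (min k (2 * J - k)) \<le> real J" by simp
  hence "tent J \<delta> k \<le> \<delta> / real J * real J"
    unfolding tent_def using assms by (intro mult_left_mono) auto
  thus ?thesis using False by simp
qed (simp add: tent_def assms)

lemma tent_diff:
  assumes "0 \<le> \<delta>"
  shows "\<bar>tent J \<delta> (Suc k) - tent J \<delta> k\<bar> \<le> \<delta> / real J"
proof -
  have "\<bar>real (min (Suc k) (2 * J - Suc k)) - real (min k (2 * J - k))\<bar> \<le> 1" by linarith
  moreover have "\<bar>tent J \<delta> (Suc k) - tent J \<delta> k\<bar> =
      \<delta> / real J * \<bar>real (min (Suc k) (2 * J - Suc k)) - real (min k (2 * J - k))\<bar>"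
    unfolding tent_def right_diff_distrib[symmetric] abs_mult using assms by simp
  ultimately show ?thesis using assms mult_left_le[of _ "\<delta> / real J"] by simp
qed

lemma sum_squares_lower: "real J ^ 3 / 3 \<le> (\<Sum>k<Suc J. (real k)\<^sup>2)"
proof (induction J)
  case (Suc J)
  have "real (Suc J) ^ 3 / 3 \<le> real J ^ 3 / 3 + (real (Suc J))\<^sup>2"
    by (simp add: power2_eq_square power3_eq_cube algebra_simps)
  with Suc show ?case by simp
qed simp

text \<open>The rising half of the tent, peak included, already gives this.\<close>

lemma tent_square_sum:
  assumes "0 \<le> \<delta>" "J \<ge> 1"
  shows "\<delta>\<^sup>2 * real J / 3 \<le> (\<Sum>k<2 * J. (tent J \<delta> k)\<^sup>2)"
proof -
  have "\<delta>\<^sup>2 * real J / 3 = (\<delta> / real J)\<^sup>2 * (real J ^ 3 / 3)"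
    using assms by (simp add: power2_eq_square power3_eq_cube)
  also have "\<dots> \<le> (\<delta> / real J)\<^sup>2 * (\<Sum>k<Suc J. (real k)\<^sup>2)"
    by (intro mult_left_mono sum_squares_lower) auto
  also have "\<dots> = (\<Sum>k<Suc J. (tent J \<delta> k)\<^sup>2)"
    unfolding sum_distrib_left by (intro sum.cong) (auto simp: tent_def power_mult_distrib power_divide min_def)
  also have "\<dots> \<le> (\<Sum>k<2 * J. (tent J \<delta> k)\<^sup>2)"
    using assms by (intro sum_mono2) auto
  finally show ?thesis .
qed

lemma sum_lessThan_shift:
  fixes f :: "nat \<Rightarrow> 'a::comm_monoid_add"
  shows "(\<Sum>k<m + n. f k) = (\<Sum>k<m. f k) + (\<Sum>k<n. f (m + k))"
  by (induction n) (simp_all add: add.assoc)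

lemma sum_index_power:
  fixes y :: complex
  shows "(1 - y)\<^sup>2 * (\<Sum>k<n. of_nat k * y ^ k) = y - of_nat n * y ^ n + (of_nat n - 1) * y ^ Suc n"
proof (induction n)
  case (Suc n)
  have "(1 - y)\<^sup>2 * (\<Sum>k<Suc n. of_nat k * y ^ k) =
      (y - of_nat n * y ^ n + (of_nat n - 1) * y ^ Suc n) + (1 - y)\<^sup>2 * (of_nat n * y ^ n)"
    by (simp only: sum.lessThan_Suc distrib_left Suc)
  thus ?case by (simp add: power2_eq_square algebra_simps)
qed simp

text \<open>The tent is the convolution square of a block of \<open>J\<close> ones, shifted by 1, so
  its generating polynomial is \<open>y\<close> times a squared geometric sum.\<close>

lemma sum_tent_power:
  fixes y :: complex
  shows "(1 - y)\<^sup>2 * (\<Sum>k<2 * J. of_nat (min k (2 * J - k)) * y ^ k) = y * (1 - y ^ J)\<^sup>2"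
proof -
  define S where "S = (\<Sum>k<J. of_nat k * y ^ k)"
  define P where "P = (\<Sum>k<J. y ^ k)"
  have "(\<Sum>k<2 * J. of_nat (min k (2 * J - k)) * y ^ k) =
      (\<Sum>k<J. of_nat (min k (2 * J - k)) * y ^ k) + (\<Sum>k<J. of_nat (min (J + k) (2 * J - (J + k))) * y ^ (J + k))"
    using sum_lessThan_shift[of "\<lambda>k. of_nat (min k (2 * J - k)) * y ^ k" J J] by (simp add: mult_2)
  also have "(\<Sum>k<J. of_nat (min k (2 * J - k)) * y ^ k) = S"
    unfolding S_def by (intro sum.cong) (auto simp: min_def)
  also have "(\<Sum>k<J. of_nat (min (J + k) (2 * J - (J + k))) * y ^ (J + k)) =
      (\<Sum>k<J. y ^ J * (of_nat J * y ^ k - of_nat k * y ^ k))"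
  proof (rule sum.cong)
    fix k assume "k \<in> {..<J}"
    hence "min (J + k) (2 * J - (J + k)) = J - k" "k \<le> J" by auto
    thus "of_nat (min (J + k) (2 * J - (J + k))) * y ^ (J + k) = y ^ J * (of_nat J * y ^ k - of_nat k * y ^ k)"
      by (simp only: of_nat_diff) (simp add: power_add algebra_simps)
  qed simp
  also have "\<dots> = y ^ J * (of_nat J * P - S)"
    by (simp add: S_def P_def sum_subtractf flip: sum_distrib_left)
  finally have eq: "(\<Sum>k<2 * J. of_nat (min k (2 * J - k)) * y ^ k) = S + y ^ J * (of_nat J * P - S)" .
  have "(1 - y)\<^sup>2 * (\<Sum>k<2 * J. of_nat (min k (2 * J - k)) * y ^ k) =
      (1 - y)\<^sup>2 * S + y ^ J * (of_nat J * ((1 - y) * ((1 - y) * P)) - (1 - y)\<^sup>2 * S)"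
    unfolding eq by (simp add: power2_eq_square algebra_simps)
  also have "(1 - y) * P = 1 - y ^ J"
    using one_diff_power_eq[of y J] by (simp add: P_def)
  also have "(1 - y)\<^sup>2 * S = y - of_nat J * y ^ J + (of_nat J - 1) * y ^ Suc J"
    unfolding S_def by (rule sum_index_power)
  finally show ?thesis by (simp add: power2_eq_square algebra_simps)
qed

text \<open>Here \<open>m\<close> measures the distance to the centre of the bump in units of 1 / J.
  The first-order main term is kept exactly and all errors are of order
  \<open>1 / m\<^sup>2\<close>, hence summable over the blocks.\<close>

lemma tent_block_estimate:
  fixes y :: complex and \<epsilon> m :: real and J :: nat
  defines "\<gamma> \<equiv> \<lambda>k. of_real (tent J (\<epsilon> / real J) k) * y ^ k"
  assumes \<epsilon>: "0 < \<epsilon>" "\<epsilon> \<le> 1 / 200" and J: "J \<ge> 1" and m: "1 \<le> m"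
    and y: "norm y = 1" "m / (2 * real J) \<le> cmod (1 - y)"
  shows "Im (- 1 / (1 - cnj y)) * (\<Sum>k<2 * J. (tent J (\<epsilon> / real J) k)\<^sup>2) - 1 / (4 * m\<^sup>2)
      \<le> szego_arg \<gamma> (2 * J) 1"
    and "cmod (szegoB \<gamma> (2 * J) 1) / cmod (szegoA \<gamma> (2 * J) 1) \<le> 1 / (4 * m\<^sup>2)"
proof -
  define \<delta> where "\<delta> = \<epsilon> / real J"
  define G where "G = tent J \<delta>"
  define x where "x = cmod (1 - y)"
  define L where "L = (\<lambda>n. \<Sum>k<n. of_real (G k) * y ^ k)"
  define l where "l = 3 * \<delta> / x"
  have \<gamma>: "\<gamma> = (\<lambda>k. of_real (G k) * y ^ k)" by (simp add: \<gamma>_def G_def \<delta>_def)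
  have J0: "real J > 0" using J by simp
  have \<delta>: "0 \<le> \<delta>" using \<epsilon> by (simp add: \<delta>_def)
  have mx: "m \<le> 2 * real J * x" using y(2) J0 by (simp add: x_def field_simps)
  have "x \<noteq> 0" using mx m by auto
  hence x: "x > 0" by (simp add: x_def)
  have y1: "y \<noteq> 1" using x by (auto simp: x_def)
  have jx: "1 / (real J * x) \<le> 2 / m"
  proof -
    have "1 / (real J * x) \<le> 1 / (m / 2)" using mx x m J0 by (intro divide_left_mono mult_pos_pos) auto
    thus ?thesis by simp
  qed
  have dx: "\<delta> / x \<le> 2 * \<epsilon> / m"
    using mult_left_mono[OF jx, of \<epsilon>] \<epsilon>(1) by (simp add: \<delta>_def mult.commute)
  have l0: "0 \<le> l" using \<delta> x by (simp add: l_def)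
  have lm: "l \<le> 6 * \<epsilon> / m" using dx by (simp add: l_def)
  have "6 * \<epsilon> / m \<le> 6 * \<epsilon> / 1" using m \<epsilon> by (intro divide_left_mono) auto
  hence l14: "l \<le> 1/4" using lm \<epsilon> by simp
  have l2: "l\<^sup>2 \<le> 36 * \<epsilon>\<^sup>2 / m\<^sup>2"
    using power_mono[OF lm l0, of 2] by (simp add: power_divide power_mult_distrib)
  have Gabs: "\<bar>G k\<bar> \<le> \<delta>" for k
    using tent_nonneg[OF \<delta>, of J k] tent_le[OF \<delta>, of J k] by (simp add: G_def)
  have G0: "G 0 = 0" by (simp add: G_def tent_def)
  have Gd: "\<bar>G (Suc k) - G k\<bar> \<le> \<delta> / real J" for k unfolding G_def by (rule tent_diff[OF \<delta>])
  have Dd: "real (2 * J) * (\<delta> / real J) \<le> 2 * \<delta>" using J0 by simp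
  note ac = autocorrelation_estimate[where G = G and y = y and D = "2 * J", OF y(1) y1 G0 Gabs Gd Dd]
  have est: "n \<le> 2 * J \<Longrightarrow> cmod (L n) \<le> l"
    "cmod ((\<Sum>k<2 * J. of_real (G k) * y ^ k * cnj (L k)) + of_real (\<Sum>k<2 * J. (G k)\<^sup>2) / (1 - cnj y))
      \<le> 12 * \<delta>\<^sup>2 / x\<^sup>2" for n
    unfolding L_def l_def x_def by (rule ac(1), assumption, rule ac(2))
  have s: "(\<Sum>k<2 * J. cmod (\<gamma> k)) \<le> 2 * \<epsilon>"
  proof -
    have "(\<Sum>k<2 * J. cmod (\<gamma> k)) \<le> (\<Sum>k<2 * J. \<delta>)"
      unfolding \<gamma> by (intro sum_mono) (simp add: norm_mult norm_power y(1) Gabs)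
    thus ?thesis using J0 by (simp add: \<delta>_def)
  qed
  have L\<gamma>: "(\<Sum>k<n. \<gamma> k) = L n" for n by (simp add: \<gamma> L_def)
  have e14: "2 * \<epsilon> \<le> 1/4" using \<epsilon> by simp
  note pert = szego_perturbation[of \<gamma> "2 * J" "2 * \<epsilon>" l, unfolded L\<gamma>, OF s e14 est(1) l14]
  \<comment> \<open>The squared Dirichlet kernel gives a second factor \<open>1 / (J * x)\<close>,
    which the bound \<open>l\<close> for partial sums lacks.\<close>
  have LD: "cmod (L (2 * J)) \<le> 16 * \<epsilon> / m\<^sup>2"
  proof -
    have "L (2 * J) = of_real (\<delta> / real J) * (\<Sum>k<2 * J. of_nat (min k (2 * J - k)) * y ^ k)"
      unfolding L_def sum_distrib_left 
      by (simp only: G_def tent_def of_real_mult of_real_of_nat_eq mult.assoc)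
    hence "(1 - y)\<^sup>2 * L (2 * J) = of_real (\<delta> / real J) * (y * (1 - y ^ J)\<^sup>2)"
      by (simp only: mult.left_commute[of "(1 - y)\<^sup>2"] sum_tent_power)
    from arg_cong[OF this, of cmod]
    have "x\<^sup>2 * cmod (L (2 * J)) = \<delta> / real J * (cmod (1 - y ^ J))\<^sup>2"
      unfolding x_def norm_mult norm_power norm_of_real y(1) using \<delta> by simp
    also have "\<dots> \<le> \<delta> / real J * 2\<^sup>2"
      using norm_triangle_ineq4[of 1 "y ^ J"] \<delta>
      by (intro mult_left_mono power_mono) (auto simp: norm_power y(1))
    finally have "cmod (L (2 * J)) \<le> \<delta> / real J * 2\<^sup>2 / x\<^sup>2"
      using x by (subst pos_le_divide_eq) (simp_all add: mult.commute)
    also have "\<dots> = 4 * \<epsilon> * (1 / (real J * x))\<^sup>2" by (simp add: \<delta>_def power2_eq_square mult_ac)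
    also have "\<dots> \<le> 4 * \<epsilon> * (2 / m)\<^sup>2"
      using jx \<epsilon> x J0 by (intro mult_left_mono power_mono) auto
    finally show ?thesis by (simp add: power_divide)
  qed
  have m2: "m\<^sup>2 > 0" using m by simp
  have e2: "\<epsilon>\<^sup>2 \<le> (1/200)\<^sup>2" using \<epsilon> by (intro power_mono) auto
  have e3: "\<epsilon> * \<epsilon>\<^sup>2 \<le> 1/200 * (1/200)\<^sup>2" using \<epsilon> e2 by (intro mult_mono) auto
  have e4: "\<epsilon>\<^sup>2 * \<epsilon>\<^sup>2 \<le> (1/200)\<^sup>2 * (1/200)\<^sup>2" using e2 by (intro mult_mono) auto
  have "cmod (szegoB \<gamma> (2 * J) 1) / cmod (szegoA \<gamma> (2 * J) 1) \<le> 3 * cmod (L (2 * J)) + 6 * l\<^sup>2 * (2 * \<epsilon>)"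
    by (rule pert(2))
  also have "\<dots> \<le> 3 * (16 * \<epsilon> / m\<^sup>2) + 6 * (36 * \<epsilon>\<^sup>2 / m\<^sup>2) * (2 * \<epsilon>)"
    using LD l2 \<epsilon> by (intro add_mono mult_left_mono mult_right_mono) auto
  also have "\<dots> = (48 * \<epsilon> + 432 * (\<epsilon> * \<epsilon>\<^sup>2)) / m\<^sup>2" by (simp add: add_divide_distrib)
  \<comment> \<open>The bound 1/200 on \<open>\<epsilon>\<close> is dictated by this place:
    \<open>48 * \<epsilon>\<close> has to stay below 1/4.\<close>
  also have "\<dots> \<le> (1/4) / m\<^sup>2" using \<epsilon> e3 m2 by (intro divide_right_mono) (auto simp: power2_eq_square)
  finally show "cmod (szegoB \<gamma> (2 * J) 1) / cmod (szegoA \<gamma> (2 * J) 1) \<le> 1 / (4 * m\<^sup>2)" by simp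
  define S where "S = (\<Sum>k<2 * J. (G k)\<^sup>2)"
  define Q where "Q = (\<Sum>k<2 * J. \<gamma> k * cnj (L k))"
  have "\<bar>Im (Q + of_real S / (1 - cnj y))\<bar> \<le> 12 * \<delta>\<^sup>2 / x\<^sup>2"
    by (rule order_trans[OF abs_Im_le_cmod]) (use est(2) in \<open>simp add: Q_def S_def \<gamma>\<close>)
  moreover have "Im (of_real S / (1 - cnj y)) = - (Im (- 1 / (1 - cnj y)) * S)"
  proof -
    have "of_real S / (1 - cnj y) = of_real (- S) * (- 1 / (1 - cnj y))" by simp
    thus ?thesis by (simp only: Im_complex_of_real Re_complex_of_real times_complex.sel) simp
  qed
  moreover have "12 * \<delta>\<^sup>2 / x\<^sup>2 \<le> 48 * \<epsilon>\<^sup>2 / m\<^sup>2"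
  proof -
    have "(\<delta> / x)\<^sup>2 \<le> (2 * \<epsilon> / m)\<^sup>2" using \<delta> x by (intro power_mono dx) auto
    thus ?thesis by (simp add: power_divide power_mult_distrib)
  qed
  moreover have "\<bar>szego_arg \<gamma> (2 * J) 1 - Im Q\<bar> \<le> 90 * (2 * \<epsilon>)\<^sup>2 * l\<^sup>2"
    unfolding Q_def by (rule pert(1))
  moreover have "90 * (2 * \<epsilon>)\<^sup>2 * l\<^sup>2 \<le> 90 * (2 * \<epsilon>)\<^sup>2 * (36 * \<epsilon>\<^sup>2 / m\<^sup>2)"
    using l2 by (intro mult_left_mono) auto
  moreover have "48 * \<epsilon>\<^sup>2 / m\<^sup>2 + 90 * (2 * \<epsilon>)\<^sup>2 * (36 * \<epsilon>\<^sup>2 / m\<^sup>2) \<le> 1 / (4 * m\<^sup>2)"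
  proof -
    have "48 * \<epsilon>\<^sup>2 / m\<^sup>2 + 90 * (2 * \<epsilon>)\<^sup>2 * (36 * \<epsilon>\<^sup>2 / m\<^sup>2) = (48 * \<epsilon>\<^sup>2 + 12960 * (\<epsilon>\<^sup>2 * \<epsilon>\<^sup>2)) / m\<^sup>2"
      by (simp add: add_divide_distrib power_mult_distrib)
    also have "\<dots> \<le> (1/4) / m\<^sup>2" using e2 e4 m2 by (intro divide_right_mono) (auto simp: power2_eq_square)
    finally show ?thesis by simp
  qed
  ultimately have "Im (- 1 / (1 - cnj y)) * S - 1 / (4 * m\<^sup>2) \<le> szego_arg \<gamma> (2 * J) 1"
    by (simp only: plus_complex.sel)
  thus "Im (- 1 / (1 - cnj y)) * (\<Sum>k<2 * J. (tent J (\<epsilon> / real J) k)\<^sup>2) - 1 / (4 * m\<^sup>2)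
      \<le> szego_arg \<gamma> (2 * J) 1"
    by (simp only: S_def G_def \<delta>_def)
qed

section \<open>Trigonometric bounds within a quarter turn\<close>

lemma cos_ge_half:
  assumes "0 \<le> u" "u \<le> pi / 4"
  shows "1/2 \<le> cos u"
  using cos_monotone_0_pi_le[of u "pi/3"] assms by (simp add: cos_60)

lemma sin_ge_half_self:
  assumes "0 \<le> u" "u \<le> pi / 4"
  shows "u / 2 \<le> sin u"
proof -
  have "sin 0 - 0 / 2 \<le> sin u - u / 2"
  proof (rule DERIV_nonneg_imp_nondecreasing[OF assms(1)])
    fix t assume t: "0 \<le> t" "t \<le> u"
    show "\<exists>y. DERIV (\<lambda>u. sin u - u / 2) t :> y \<and> 0 \<le> y"
      using cos_ge_half[of t] t assms
      by (intro exI[of _ "cos t - 1/2"]) (auto intro!: derivative_eq_intros)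
  qed
  thus ?thesis by simp
qed

lemma cmod_one_minus_cis_ge:
  assumes "0 \<le> d" "d \<le> pi / 2"
  shows "d / 2 \<le> cmod (1 - cis d)"
proof -
  have "(cmod (1 - cis d))\<^sup>2 = 2 - 2 * cos d"
    by (simp add: cmod_power2 power2_diff sin_squared_eq)
  also have "\<dots> = (2 * sin (d/2))\<^sup>2" using cos_double_sin[of "d/2"] by (simp add: power_mult_distrib)
  finally have "(2 * sin (d/2))\<^sup>2 \<le> (cmod (1 - cis d))\<^sup>2" by simp
  hence "2 * sin (d/2) \<le> cmod (1 - cis d)" by (rule power2_le_imp_le) simp
  moreover have "d / 2 / 2 \<le> sin (d/2)" using assms by (intro sin_ge_half_self) auto
  ultimately show ?thesis by linarith
qed

text \<open>The imaginary part is \<open>cot (d/2) / 2\<close>. Its positivity means that all blocks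
  within a quarter turn before the point push the argument in the same direction.\<close>

lemma Im_cauchy_kernel_cis:
  assumes "0 < d" "d \<le> pi / 2"
  shows "1 / (2 * d) \<le> Im (- 1 / (1 - cnj (cis d)))"
proof -
  have sp: "0 < sin (d/2)" using assms by (intro sin_gt_zero) auto
  have "1 \<noteq> cis (- d)"
    using sin_gt_zero[of d] assms by (auto simp: complex_eq_iff)
  hence "- 1 / (1 - cnj (cis d)) = ((cis (- d) + 1) / (cis (- d) - 1) - 1) / 2"
    by (simp add: cis_cnj field_simps)
  also have "\<dots> = (\<i> * of_real (cot (d/2)) - 1) / 2" using cot_half_cis[of d] sp by simp
  finally have eq: "- 1 / (1 - cnj (cis d)) = (\<i> * of_real (cot (d/2)) - 1) / 2" .
  have "Im (- 1 / (1 - cnj (cis d))) = cot (d/2) / 2" unfolding eq by simp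
  moreover have "(1/2) / (d/2) \<le> cos (d/2) / sin (d/2)"
  proof (rule frac_le)
    show "1/2 \<le> cos (d/2)" using assms by (intro cos_ge_half) auto
    thus "0 \<le> cos (d/2)" by simp
    show "sin (d/2) \<le> d/2" using assms by (intro sin_x_le_x) auto
  qed (rule sp)
  ultimately show ?thesis by (simp add: cot_def)
qed

section \<open>The sweeping sequence\<close>

text \<open>The negative frequency centres the bump at angle \<open>pi * i / (2 * J)\<close>. The
  power runs over the index inside the block, which is the form that \<open>szego_concat\<close>
  expects.\<close>

definition tent_block :: "nat \<Rightarrow> real \<Rightarrow> nat \<Rightarrow> nat \<Rightarrow> complex" where
  "tent_block J \<epsilon> i k = of_real (tent J (\<epsilon> / real J) k) * cis (- (pi * real i / (2 * real J))) ^ k"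

text \<open>The blocks sweep an angle of \<open>5 * pi / 2\<close>, so that every point of the circle is reached
  after a full quarter turn.\<close>
definition sweep :: "nat \<Rightarrow> real \<Rightarrow> nat \<Rightarrow> complex" where
  "sweep J \<epsilon> n = (if n < 5 * J * (2 * J) then tent_block J \<epsilon> (n div (2 * J)) (n mod (2 * J)) else 0)"

lemma norm_tent_block_le:
  assumes "0 \<le> \<epsilon>"
  shows "cmod (tent_block J \<epsilon> i k) \<le> \<epsilon> / real J"
  using tent_nonneg[of "\<epsilon> / real J" J k] tent_le[of "\<epsilon> / real J" J k] assms
  by (simp add: tent_block_def norm_mult norm_power)

lemma norm_sweep_le:
  assumes "0 \<le> \<epsilon>"
  shows "cmod (sweep J \<epsilon> n) \<le> \<epsilon> / real J"
  using norm_tent_block_le[OF assms] assms by (simp add: sweep_def)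

lemma sweep_block:
  assumes "i < 5 * J" "k < 2 * J"
  shows "sweep J \<epsilon> (i * (2 * J) + k) = tent_block J \<epsilon> i k"
proof -
  have "i * (2 * J) + k < Suc i * (2 * J)" using assms(2) by simp
  also have "\<dots> \<le> 5 * J * (2 * J)" using assms(1) by (intro mult_right_mono) auto
  finally show ?thesis using assms(2) by (simp add: sweep_def)
qed

text \<open>The gain is \<open>1 / (2 * t)\<close> times the square sum of the tent, at least
  \<open>\<epsilon>\<^sup>2 / (3 * pi * (m + 1))\<close>, and pi < 4 gives the 12. The loss is a
  quarter of \<open>1 / m\<^sup>2\<close> from the block and a half from the concatenation. The
  condition \<open>m < J\<close> keeps \<open>t\<close> within a quarter turn.\<close>

lemma sweep_step:
  assumes \<epsilon>: "0 < \<epsilon>" "\<epsilon> \<le> 1 / 200" and J: "J \<ge> 1" and i: "i < 5 * J"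
    and m: "1 \<le> m" "m < J"
    and d: "pi * real m / (2 * real J) \<le> x - pi * real i / (2 * real J)"
      "x - pi * real i / (2 * real J) \<le> pi * real (Suc m) / (2 * real J)"
  shows "szego_arg (sweep J \<epsilon>) (i * (2 * J)) (cis x) + (\<epsilon>\<^sup>2 / 12 * (1 / real (Suc m)) - 1 / (real m)\<^sup>2)
    \<le> szego_arg (sweep J \<epsilon>) (Suc i * (2 * J)) (cis x)"
proof -
  define t where "t = x - pi * real i / (2 * real J)"
  define y where "y = cis t"
  define h where "h = tent_block J \<epsilon> i"
  define \<gamma> where "\<gamma> = (\<lambda>k. complex_of_real (tent J (\<epsilon> / real J) k) * y ^ k)"
  have J0: "real J > 0" using J by simp
  have m0: "real m > 0" using m by simp
  have small: "\<epsilon> / real J < 1"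
  proof -
    have "\<epsilon> / real J \<le> \<epsilon> / 1" using \<epsilon> J by (intro divide_left_mono) auto
    thus ?thesis using \<epsilon> by simp
  qed
  have t0: "0 < t" using d(1) m0 J0 by (intro less_le_trans[OF _ d(1)[folded t_def]]) simp
  have "real (Suc m) \<le> real J" using m by (intro of_nat_mono) simp
  hence "pi * real (Suc m) \<le> pi * real J" by simp
  hence "pi * real (Suc m) / (2 * real J) \<le> pi / 2" using J0 by (simp add: field_simps)
  hence t2: "t \<le> pi / 2" using d(2) by (simp add: t_def)
  have "real m / (2 * real J) \<le> pi * real m / (2 * real J) / 2"
    using pi_gt3 m0 J0 by (simp add: field_simps)
  also have "\<dots> \<le> t / 2" using d(1) by (simp add: t_def)
  also have "\<dots> \<le> cmod (1 - y)" unfolding y_def using t0 t2 by (intro cmod_one_minus_cis_ge) auto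
  finally have y: "real m / (2 * real J) \<le> cmod (1 - y)" .
  have m1: "1 \<le> real m" using m by simp
  note block = tent_block_estimate[OF \<epsilon> J m1 _ y, folded \<gamma>_def]
  have y1: "norm y = 1" by (simp add: y_def)
  have "h k * cis x ^ k = \<gamma> k" for k
  proof -
    have "cis (- (pi * real i / (2 * real J))) ^ k * cis x ^ k = y ^ k"
      unfolding power_mult_distrib[symmetric] y_def t_def by (simp add: cis_mult)
    thus ?thesis by (simp add: h_def tent_block_def \<gamma>_def mult.assoc)
  qed
  hence h\<gamma>: "(\<lambda>k. h k * cis x ^ k) = \<gamma>" by auto
  have harg: "szego_arg h (2 * J) (cis x) = szego_arg \<gamma> (2 * J) 1"
    using szego_arg_rotate[of "cis x" h "2 * J"] by (simp add: h\<gamma>)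
  have hA: "cmod (szegoA h (2 * J) (cis x)) = cmod (szegoA \<gamma> (2 * J) 1)"
    using szego_rotate[of "cis x" h "2 * J"] by (simp add: h\<gamma>)
  have "cmod (cis x * szegoB h (2 * J) (cis x)) = cmod (cis x ^ (2 * J) * szegoB \<gamma> (2 * J) 1)"
    using szego_rotate[of "cis x" h "2 * J"] by (simp add: h\<gamma>)
  hence hB: "cmod (szegoB h (2 * J) (cis x)) = cmod (szegoB \<gamma> (2 * J) 1)"
    by (simp add: norm_mult norm_power)
  have g1: "cmod (sweep J \<epsilon> k) < 1" for k using norm_sweep_le[of \<epsilon> J k] \<epsilon> small by simp
  have h1: "cmod (h k) < 1" for k unfolding h_def using norm_tent_block_le[of \<epsilon> J i k] \<epsilon> small by simp
  have hk: "sweep J \<epsilon> (i * (2 * J) + k) = h k" if "k < 2 * J" for k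
    unfolding h_def by (rule sweep_block[OF i that])
  obtain r where r: "cmod r \<le> cmod (szegoB h (2 * J) (cis x)) / cmod (szegoA h (2 * J) (cis x))"
    "szego_arg (sweep J \<epsilon>) (i * (2 * J) + 2 * J) (cis x) =
       szego_arg (sweep J \<epsilon>) (i * (2 * J)) (cis x) + szego_arg h (2 * J) (cis x) + Im (Ln (1 + r))"
    by (rule szego_arg_concat[where g = "sweep J \<epsilon>" and h = h and n = "2 * J" and p = "i * (2 * J)"
          and z = "cis x", OF g1 h1 hk norm_cis])
  have r4: "cmod r \<le> 1 / (4 * (real m)\<^sup>2)"
    using r(1) block(2)[OF y1] by (simp only: hA hB)
  have "1 / (4 * (real m)\<^sup>2) \<le> 1 / (4 * 1)" using m1 by (intro divide_left_mono) auto
  \<comment> \<open>Smallness of \<open>r\<close> allows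
    \<open>|Ln (1 + r)| \<le> 2 * |r|\<close>.\<close>
  hence "cmod r < 1/2" using r4 by simp
  hence "cmod (Ln (1 + r)) \<le> 2 * cmod r" by (rule norm_Ln_le)
  hence "\<bar>Im (Ln (1 + r))\<bar> \<le> 2 * (1 / (4 * (real m)\<^sup>2))" using abs_Im_le_cmod[of "Ln (1 + r)"] r4 by linarith
  moreover have "\<epsilon>\<^sup>2 / 12 * (1 / real (Suc m)) - 1 / (4 * (real m)\<^sup>2) \<le> szego_arg \<gamma> (2 * J) 1"
  proof -
    have "\<epsilon>\<^sup>2 / 12 * (1 / real (Suc m)) \<le> \<epsilon>\<^sup>2 / (3 * pi) * (1 / real (Suc m))"
      using pi_less_4 by (intro mult_right_mono divide_left_mono) auto
    also have "\<dots> = 1 / (2 * (pi * real (Suc m) / (2 * real J))) * ((\<epsilon> / real J)\<^sup>2 * real J / 3)"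
    proof -
      have gen: "\<epsilon>\<^sup>2 / (3 * pi) * (1 / q) = 1 / (2 * (pi * q / (2 * real J))) * ((\<epsilon> / real J)\<^sup>2 * real J / 3)"
        if "q > 0" for q
        using J0 that by (simp add: divide_simps power2_eq_square)
      show ?thesis by (rule gen) simp
    qed
    also have "\<dots> \<le> 1 / (2 * t) * ((\<epsilon> / real J)\<^sup>2 * real J / 3)"
    proof (intro mult_right_mono divide_left_mono)
      show "2 * t \<le> 2 * (pi * real (Suc m) / (2 * real J))"
        using d(2) unfolding t_def by (intro mult_left_mono) simp_all
      show "0 < 2 * (pi * real (Suc m) / (2 * real J)) * (2 * t)"
        using t0 J0 by (intro mult_pos_pos divide_pos_pos) auto
    qed auto
    also have "\<dots> \<le> Im (- 1 / (1 - cnj y)) * (\<Sum>k<2 * J. (tent J (\<epsilon> / real J) k)\<^sup>2)"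
    proof (rule mult_mono)
      show le: "1 / (2 * t) \<le> Im (- 1 / (1 - cnj y))" unfolding y_def by (rule Im_cauchy_kernel_cis[OF t0 t2])
      have "0 \<le> 1 / (2 * t)" using t0 by simp
      with le show "0 \<le> Im (- 1 / (1 - cnj y))" by linarith
      show "(\<epsilon> / real J)\<^sup>2 * real J / 3 \<le> (\<Sum>k<2 * J. (tent J (\<epsilon> / real J) k)\<^sup>2)"
        using \<epsilon> J by (intro tent_square_sum) auto
    qed simp
    finally show ?thesis using block(1)[OF y1] by linarith
  qed
  moreover have "2 * (1 / (4 * (real m)\<^sup>2)) + 1 / (4 * (real m)\<^sup>2) \<le> 1 / (real m)\<^sup>2"
    using m0 by (simp add: field_simps)
  moreover have "szego_arg (sweep J \<epsilon>) (Suc i * (2 * J)) (cis x) =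
       szego_arg (sweep J \<epsilon>) (i * (2 * J)) (cis x) + szego_arg \<gamma> (2 * J) 1 + Im (Ln (1 + r))"
    using r(2) harg by (simp add: add.commute)
  ultimately show ?thesis by linarith
qed

text \<open>The blocks \<open>k - 1\<close>, ..., \<open>k - (J - 1)\<close> lie 1, ...,
  \<open>J - 1\<close> grid steps before the cell of \<open>x\<close>; their gains form a harmonic
  sum and their losses a convergent one. Block \<open>k\<close>, whose centre may coincide with
  \<open>x\<close>, is left out.\<close>

lemma sweep_arg_growth:
  assumes \<epsilon>: "0 < \<epsilon>" "\<epsilon> \<le> 1 / 200" and J: "J \<ge> 1" and k: "J \<le> k" "k < 5 * J"
    and x: "pi * real k / (2 * real J) \<le> x" "x \<le> pi * real (Suc k) / (2 * real J)"
  shows "\<epsilon>\<^sup>2 / 12 * (harm J - 1) - 2 \<le>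
    szego_arg (sweep J \<epsilon>) (k * (2 * J)) (cis x) - szego_arg (sweep J \<epsilon>) ((k - (J - 1)) * (2 * J)) (cis x)"
proof -
  define f where "f = (\<lambda>i. szego_arg (sweep J \<epsilon>) (i * (2 * J)) (cis x))"
  \<comment> \<open>The loss is carried as \<open>2 * (1 - 1 / (M + 1))\<close>, a telescoping
    majorant of the sum of \<open>1 / m\<^sup>2\<close>.\<close>
  have "\<epsilon>\<^sup>2 / 12 * (harm (Suc M) - 1) - 2 * (1 - 1 / real (Suc M)) \<le> f k - f (k - M)" if "M < J" for M
    using that
  proof (induction M)
    case 0
    show ?case by (simp add: harm_expand)
  next
    case (Suc M)
    define i where "i = k - Suc M"
    have i: "i < 5 * J" "k = i + Suc M" "Suc i = k - M" using Suc.prems k by (auto simp: i_def)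
    have e1: "pi * real (Suc M) / (2 * real J) = pi * real k / (2 * real J) - pi * real i / (2 * real J)"
      unfolding i(2) by (simp add: add_divide_distrib algebra_simps)
    have e2: "pi * real (Suc (Suc M)) / (2 * real J) = pi * real (Suc k) / (2 * real J) - pi * real i / (2 * real J)"
      unfolding i(2) by (simp add: add_divide_distrib algebra_simps)
    have d1: "pi * real (Suc M) / (2 * real J) \<le> x - pi * real i / (2 * real J)"
      unfolding e1 using x(1) by linarith
    have d2: "x - pi * real i / (2 * real J) \<le> pi * real (Suc (Suc M)) / (2 * real J)"
      unfolding e2 using x(2) by linarith
    have "f i + (\<epsilon>\<^sup>2 / 12 * (1 / real (Suc (Suc M))) - 1 / (real (Suc M))\<^sup>2) \<le> f (Suc i)"
      unfolding f_def
      by (rule sweep_step[OF \<epsilon> J i(1) _ Suc.prems d1 d2]) simp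
    moreover have "1 / (real (Suc M))\<^sup>2 \<le> 2 * (1 / real (Suc M) - 1 / real (Suc (Suc M)))"
    proof -
      have "1 / a\<^sup>2 \<le> 2 * (1 / a - 1 / (a + 1))" if "a \<ge> 1" for a :: real
      proof -
        have "1 / a\<^sup>2 = 2 / (a * (2 * a))" using that by (simp add: power2_eq_square)
        also have "\<dots> \<le> 2 / (a * (a + 1))" using that by (intro divide_left_mono mult_left_mono) auto
        also have "\<dots> = 2 * (1 / a - 1 / (a + 1))" using that by (simp add: field_simps)
        finally show ?thesis .
      qed
      from this[of "real (Suc M)"] show ?thesis by (simp add: add.commute)
    qed
    moreover have "\<epsilon>\<^sup>2 / 12 * (harm (Suc (Suc M)) - 1) = \<epsilon>\<^sup>2 / 12 * (harm (Suc M) - 1) + \<epsilon>\<^sup>2 / 12 * (1 / real (Suc (Suc M)))"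
      by (simp only: harm_Suc[of "Suc M"] inverse_eq_divide distrib_left[symmetric]) simp
    moreover have "\<epsilon>\<^sup>2 / 12 * (harm (Suc M) - 1) - 2 * (1 - 1 / real (Suc M)) \<le> f k - f (Suc i)"
      unfolding i(3) using Suc by simp
    ultimately show ?case unfolding i_def[symmetric] by argo
  qed
  from this[of "J - 1"] J have "\<epsilon>\<^sup>2 / 12 * (harm J - 1) - 2 * (1 - 1 / real J) \<le> f k - f (k - (J - 1))" by simp
  moreover have "2 * (1 - 1 / real J) \<le> 2" by simp
  ultimately show ?thesis unfolding f_def by linarith
qed

section \<open>The sequence on the integers and the conclusion\<close>

text \<open>With support in the nonnegative integers, symmetric truncation cuts only at the upper
  end, that is, it stops the sweep.\<close>

definition sweep_int :: "nat \<Rightarrow> real \<Rightarrow> int \<Rightarrow> complex" where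
  "sweep_int J \<epsilon> n = (if n < 0 then 0 else sweep J \<epsilon> (nat n))"

lemma sweep_int_support:
  assumes nz: "sweep_int J \<epsilon> n \<noteq> 0"
  shows "n \<in> int ` {..<10 * J\<^sup>2}"
proof -
  have "0 \<le> n" using nz by (auto simp: sweep_int_def split: if_splits)
  moreover have "nat n < 5 * J * (2 * J)"
    using nz by (auto simp: sweep_int_def sweep_def split: if_splits)
  ultimately show ?thesis by (intro image_eqI[of _ _ "nat n"]) (simp_all add: power2_eq_square)
qed

lemma norm_sweep_int_le:
  assumes "0 \<le> \<epsilon>"
  shows "cmod (sweep_int J \<epsilon> n) \<le> \<epsilon> / real J"
  using norm_sweep_le[OF assms] assms by (simp add: sweep_int_def)

lemma sweep_int_Sstar:
  assumes "0 < \<epsilon>" "\<epsilon> \<le> 1 / 200" "J \<ge> 1"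
  shows "sweep_int J \<epsilon> \<in> Sstar"
proof -
  have "\<epsilon> / real J \<le> \<epsilon> / 1" using assms by (intro divide_left_mono) auto
  hence half: "cmod (sweep_int J \<epsilon> n) \<le> 1/2" for n
    using norm_sweep_int_le[of \<epsilon> J n] assms by simp
  have "\<exists>C. \<forall>n. cmod (sweep_int J \<epsilon> n) \<le> C / (1 + real_of_int \<bar>n\<bar>) ^ l" for l
  proof (intro exI allI)
    fix n
    show "cmod (sweep_int J \<epsilon> n) \<le> (1 + real (10 * J\<^sup>2)) ^ l / (1 + real_of_int \<bar>n\<bar>) ^ l"
    proof (cases "sweep_int J \<epsilon> n = 0")
      case False
      from sweep_int_support[OF this] obtain j where j: "n = int j" "j < 10 * J\<^sup>2" by auto
      have "(1 + real_of_int \<bar>n\<bar>) ^ l \<le> (1 + real (10 * J\<^sup>2)) ^ l"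
        using j by (intro power_mono) (auto simp del: of_nat_mult of_nat_power)
      hence "1 \<le> (1 + real (10 * J\<^sup>2)) ^ l / (1 + real_of_int \<bar>n\<bar>) ^ l" by (subst le_divide_eq) auto
      thus ?thesis using half[of n] by linarith
    qed simp
  qed
  thus ?thesis unfolding Sstar_def using half by (auto intro!: exI[of _ "1/2"])
qed

text \<open>There are \<open>10 * J\<^sup>2\<close> entries of size at most
  \<open>\<epsilon> / J\<close>, so the norm is bounded independently of \<open>J\<close>, which
  stays free to make \<open>harm J\<close> large.\<close>

lemma l2norm_sweep_int:
  assumes "0 \<le> \<epsilon>" "J \<ge> 1"
  shows "l2norm (sweep_int J \<epsilon>) \<le> 4 * \<epsilon>"
proof -
  let ?S = "int ` {..<10 * J\<^sup>2}"
  have "infsum (\<lambda>n. (cmod (sweep_int J \<epsilon> n))\<^sup>2) UNIV = infsum (\<lambda>n. (cmod (sweep_int J \<epsilon> n))\<^sup>2) ?S"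
    by (rule infsum_cong_neutral) (use sweep_int_support in auto)
  also have "\<dots> = (\<Sum>n\<in>?S. (cmod (sweep_int J \<epsilon> n))\<^sup>2)" by simp
  also have "\<dots> \<le> (\<Sum>n\<in>?S. (\<epsilon> / real J)\<^sup>2)"
    by (intro sum_mono power_mono norm_sweep_int_le assms) auto
  also have "\<dots> = real (10 * J\<^sup>2) * (\<epsilon> / real J)\<^sup>2" by (simp add: card_image)
  also have "\<dots> = 10 * \<epsilon>\<^sup>2" using assms by (simp add: power_divide)
  also have "\<dots> \<le> (4 * \<epsilon>)\<^sup>2" by (simp add: power_mult_distrib)
  finally show ?thesis unfolding l2norm_def using assms by (intro real_le_lsqrt) auto
qed

lemma sweep_int_arg_large:
  assumes \<epsilon>: "0 < \<epsilon>" "\<epsilon> \<le> 1 / 200" and J: "J \<ge> 1" and z: "norm z = 1"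
    and K: "2 * K \<le> \<epsilon>\<^sup>2 / 12 * (harm J - 1) - 2"
  shows "\<exists>N. K \<le> \<bar>arg_a_star (trunc N (sweep_int J \<epsilon>)) z\<bar>"
proof -
  have J0: "real J > 0" using J by simp
  \<comment> \<open>The representative of the angle in [pi/2, 5 * pi/2): a full quarter turn of
    blocks precedes it, and its cell \<open>k\<close> is below \<open>5 * J\<close>.\<close>
  define x where "x = (if Arg z < pi / 2 then Arg z + 2 * pi else Arg z)"
  have "cis (Arg z) = z" using rcis_cmod_Arg[of z] z by (simp add: rcis_def)
  hence zx: "z = cis x" by (simp add: x_def complex_eq_iff)
  have x: "pi / 2 \<le> x" "x < 5 * (pi / 2)"
    using Arg_bounded[of z] by (auto simp: x_def)
  define k where "k = nat \<lfloor>2 * real J * x / pi\<rfloor>"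
  have "0 \<le> 2 * real J * x / pi" using x J0 by simp
  hence k: "real k \<le> 2 * real J * x / pi" "2 * real J * x / pi < real (Suc k)"
    unfolding k_def by linarith+
  have "pi * real k \<le> 2 * real J * x" using k(1) by (simp add: field_simps)
  hence k1: "pi * real k / (2 * real J) \<le> x" using J0 by (simp add: field_simps)
  have "2 * real J * x \<le> pi * real (Suc k)" using k(2) by (simp add: field_simps)
  hence k2: "x \<le> pi * real (Suc k) / (2 * real J)" using J0 by (simp add: field_simps)
  have "real J \<le> 2 * real J * x / pi" using x(1) J0 by (simp add: field_simps)
  hence "real J < real (Suc k)" using k(2) by linarith
  hence kJ: "J \<le> k" by simp
  have "2 * real J * x / pi < 5 * real J" using x(2) J0 by (simp add: field_simps)
  hence "real k < real (5 * J)" using k(1) by simp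
  hence k5: "k < 5 * J" by (simp only: of_nat_less_iff)
  define f where "f = (\<lambda>i. szego_arg (sweep J \<epsilon>) (i * (2 * J)) z)"
  have "2 * K \<le> f k - f (k - (J - 1))"
    using sweep_arg_growth[OF \<epsilon> J kJ k5 k1 k2] K unfolding f_def zx by linarith
  \<comment> \<open>Two values at distance at least \<open>2 * K\<close> cannot both have modulus
    below \<open>K\<close>.\<close>
  hence or: "K \<le> \<bar>f k\<bar> \<or> K \<le> \<bar>f (k - (J - 1))\<bar>" by linarith
  have small: "cmod (sweep_int J \<epsilon> n) < 1" for n
  proof -
    have "\<epsilon> / real J \<le> \<epsilon> / 1" using \<epsilon> J by (intro divide_left_mono) auto
    thus ?thesis using norm_sweep_int_le[of \<epsilon> J n] \<epsilon> by simp
  qed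
  \<comment> \<open>Truncation at \<open>N\<close> keeps the indices 0 to \<open>N\<close>, so
    \<open>i\<close> whole blocks mean \<open>N = i * (2 * J) - 1\<close>; for \<open>i = 0\<close>
    the subtraction would be cut off.\<close>
  have arg: "arg_a_star (trunc (i * (2 * J) - 1) (sweep_int J \<epsilon>)) z = f i" if "i \<ge> 1" for i
  proof -
    have pos: "Suc (i * (2 * J) - 1) = i * (2 * J)" using that J by simp
    have "arg_a_star (trunc (i * (2 * J) - 1) (sweep_int J \<epsilon>)) z =
        szego_arg (\<lambda>k. sweep_int J \<epsilon> (int k)) (Suc (i * (2 * J) - 1)) z"
      by (rule arg_a_star_eq_szego_arg[OF _ small z]) (simp add: sweep_int_def)
    also have "(\<lambda>k. sweep_int J \<epsilon> (int k)) = sweep J \<epsilon>" by (auto simp: sweep_int_def)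
    finally show ?thesis unfolding pos f_def .
  qed
  have k0: "k \<ge> 1" "k - (J - 1) \<ge> 1" using kJ J by auto
  from or show ?thesis unfolding arg[OF k0(1), symmetric] arg[OF k0(2), symmetric] by blast
qed

theorem theorem2p3:
  fixes I :: "complex set" and \<omega> :: real
  assumes "is_arc I" and "I \<noteq> sphere 0 1" and "\<omega> > 0"
  shows "(SUP F \<in> {F \<in> Sstar. l2norm F \<le> \<omega>}.
            INF z \<in> I. SUP N \<in> (UNIV :: nat set). ereal \<bar>arg_a_star (trunc N F) z\<bar>) = \<infinity>"
proof (rule SUP_PInfty)
  fix n :: nat
  \<comment> \<open>The two bounds serve the block estimates and the norm constraint;
    \<open>\<epsilon>\<close> is fixed before \<open>J\<close> and does not depend on
    \<open>n\<close>.\<close>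
  define \<epsilon> where "\<epsilon> = min (1 / 200) (\<omega> / 4)"
  have \<epsilon>: "0 < \<epsilon>" "\<epsilon> \<le> 1 / 200" "4 * \<epsilon> \<le> \<omega>" using assms(3) by (auto simp: \<epsilon>_def)
  \<comment> \<open>Solved from the hypothesis of \<open>sweep_int_arg_large\<close> with
    \<open>K = n\<close>; divergence of the harmonic series then supplies \<open>J\<close>. The
    sequence is thus chosen before \<open>z\<close>, and only \<open>N\<close> depends on
    \<open>z\<close>.\<close>
  define H where "H = (2 * real n + 2) * 12 / \<epsilon>\<^sup>2 + 1"
  have "eventually (\<lambda>J. H \<le> harm J) sequentially"
    using harm_at_top[unfolded filterlim_at_top] by blast
  then obtain J0 where "\<And>J. J \<ge> J0 \<Longrightarrow> H \<le> harm J" unfolding eventually_sequentially by blast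
  hence "max 1 J0 \<ge> 1" "H \<le> harm (max 1 J0)" by simp_all
  then obtain J where J: "J \<ge> 1" "H \<le> harm J" by blast
  have "(2 * real n + 2) * 12 / \<epsilon>\<^sup>2 \<le> harm J - 1" using J(2) by (simp add: H_def)
  hence K: "2 * real n \<le> \<epsilon>\<^sup>2 / 12 * (harm J - 1) - 2" using \<epsilon>(1) by (simp add: field_simps)
  have "ereal (real n) \<le> (INF z\<in>I. SUP N. ereal \<bar>arg_a_star (trunc N (sweep_int J \<epsilon>)) z\<bar>)"
  proof (rule INF_greatest)
    fix z assume "z \<in> I"
    hence "norm z = 1" using assms(1) by (auto simp: is_arc_def)
    from sweep_int_arg_large[OF \<epsilon>(1,2) J(1) this K]
    obtain N where "real n \<le> \<bar>arg_a_star (trunc N (sweep_int J \<epsilon>)) z\<bar>" by blast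
    thus "ereal (real n) \<le> (SUP N. ereal \<bar>arg_a_star (trunc N (sweep_int J \<epsilon>)) z\<bar>)"
      by (intro SUP_upper2[of N]) auto
  qed
  moreover have "sweep_int J \<epsilon> \<in> {F \<in> Sstar. l2norm F \<le> \<omega>}"
    using sweep_int_Sstar[OF \<epsilon>(1,2) J(1)] l2norm_sweep_int[of \<epsilon> J] \<epsilon> J(1) by simp
  ultimately show "\<exists>F\<in>{F \<in> Sstar. l2norm F \<le> \<omega>}.
      ereal (real n) \<le> (INF z\<in>I. SUP N. ereal \<bar>arg_a_star (trunc N F) z\<bar>)" by blast
qed

end
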